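(* Let $\mathcal{A}$ be an abelian length category and let $(\mathcal{C}, \mathcal{D})$, $(\mathcal{C}', \mathcal{D}')$ be torsion pairs in $\mathcal{A}$ with $\mathcal{C}\subseteq\mathcal{C}'$. Then the set of all torsion classes in $\mathcal{C}' \cap \mathcal{D}$, ordered by inclusion, is a complete lattice isomorphic to the lattice interval $[\mathcal{C}, \mathcal{C}']$ of the complete lattice of torsion classes in $\mathcal{A}$.
   Context: An additive category is pre-abelian if every morphism has a kernel and a cokernel. A short exact sequence $0 \to X \xrightarrow{f} Y \xrightarrow{g} Z \to 0$ in a pre-abelian category is a composable pair with $f$ a kernel of $g$ and $g$ a cokernel of $f$. A torsion pair in a pre-abelian category $\mathcal{B}$ is an ordered pair $(\mathcal{T},\mathcal{F})$ of full subcategories (closed under isomorphism) such that $\mathrm{Hom}_{\mathcal{B}}(T,F)=0$ for all $T\in\mathcal{T}$, $F\in\mathcal{F}$, and for every $M \in \mathcal{B}$ there is a short exact sequence $0 \to {}_{\mathcal{T}}M \to M \to M_{\mathcal{F}} \to 0$ in $\mathcal{B}$ with ${}_{\mathcal{T}}M\in\mathcal{T}$ and $M_{\mathcal{F}}\in\mathcal{F}$; then $\mathcal{T}$ is called a torsion class. The full subcategory $\mathcal{C}'\cap\mathcal{D}$ of $\mathcal{A}$ is pre-abelian, so torsion classes in it make sense. A length category is one in which every object has finite length. *)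

theory Defs
  imports "HOL-Algebra.Complete_Lattice" "HOL-Algebra.Group"
begin

text \<open>
  A category enriched over abelian groups is a record with a set of objects and a set of arrows.
  The composite \<open>g \<cdot> f\<close> (first \<open>f\<close>, then \<open>g\<close>) is only meaningful if \<open>Cod f = Dom g\<close>, and the sum
  \<open>f \<oplus> g\<close> only if \<open>f\<close> and \<open>g\<close> are parallel; \<open>Zero X Y\<close> is the zero arrow from \<open>X\<close> to \<open>Y\<close>.
\<close>

record ('o, 'm) preadditive_data =
  Ob :: "'o set"
  Ar :: "'m set"
  Dom :: "'m \<Rightarrow> 'o"
  Cod :: "'m \<Rightarrow> 'o"
  Idt :: "'o \<Rightarrow> 'm"
  Comp :: "'m \<Rightarrow> 'm \<Rightarrow> 'm"  (infixl \<open>\<cdot>\<index>\<close> 70)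
  Add :: "'m \<Rightarrow> 'm \<Rightarrow> 'm"  (infixl \<open>\<oplus>\<index>\<close> 65)
  Zero :: "'o \<Rightarrow> 'o \<Rightarrow> 'm"

definition Hom :: "('o, 'm) preadditive_data \<Rightarrow> 'o \<Rightarrow> 'o \<Rightarrow> 'm set" where
  "Hom A X Y = {f \<in> Ar A. Dom A f = X \<and> Cod A f = Y}"

definition hom_group :: "('o, 'm) preadditive_data \<Rightarrow> 'o \<Rightarrow> 'o \<Rightarrow> 'm monoid" where
  "hom_group A X Y = \<lparr>carrier = Hom A X Y, mult = Add A, one = Zero A X Y\<rparr>"

locale category =
  fixes A :: "('o, 'm) preadditive_data" (structure)
  assumes Dom_closed: "f \<in> Ar A \<Longrightarrow> Dom A f \<in> Ob A"
    and Cod_closed: "f \<in> Ar A \<Longrightarrow> Cod A f \<in> Ob A"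
    and Idt_closed: "X \<in> Ob A \<Longrightarrow> Idt A X \<in> Hom A X X"
    and Comp_closed: "\<lbrakk>f \<in> Hom A X Y; g \<in> Hom A Y Z\<rbrakk> \<Longrightarrow> g \<cdot> f \<in> Hom A X Z"
    and Comp_Idt: "f \<in> Hom A X Y \<Longrightarrow> f \<cdot> Idt A X = f"
    and Idt_Comp: "f \<in> Hom A X Y \<Longrightarrow> Idt A Y \<cdot> f = f"
    and Comp_assoc: "\<lbrakk>f \<in> Hom A W X; g \<in> Hom A X Y; h \<in> Hom A Y Z\<rbrakk>
      \<Longrightarrow> (h \<cdot> g) \<cdot> f = h \<cdot> (g \<cdot> f)"

locale preadditive_category = category A for A :: "('o, 'm) preadditive_data" (structure) +
  assumes hom_comm_group: "\<lbrakk>X \<in> Ob A; Y \<in> Ob A\<rbrakk> \<Longrightarrow> comm_group (hom_group A X Y)"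
    and Comp_Add: "\<lbrakk>f \<in> Hom A X Y; g \<in> Hom A Y Z; g' \<in> Hom A Y Z\<rbrakk>
      \<Longrightarrow> (g \<oplus> g') \<cdot> f = (g \<cdot> f) \<oplus> (g' \<cdot> f)"
    and Add_Comp: "\<lbrakk>f \<in> Hom A X Y; f' \<in> Hom A X Y; g \<in> Hom A Y Z\<rbrakk>
      \<Longrightarrow> g \<cdot> (f \<oplus> f') = (g \<cdot> f) \<oplus> (g \<cdot> f')"

definition is_zero_object :: "('o, 'm) preadditive_data \<Rightarrow> 'o \<Rightarrow> bool" where
  "is_zero_object A Z \<longleftrightarrow> Z \<in> Ob A \<and>
    (\<forall>X \<in> Ob A. (\<exists>!f. f \<in> Hom A X Z) \<and> (\<exists>!f. f \<in> Hom A Z X))"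

definition is_biproduct ::
  "('o, 'm) preadditive_data \<Rightarrow> 'o \<Rightarrow> 'o \<Rightarrow> 'o \<Rightarrow> 'm \<Rightarrow> 'm \<Rightarrow> 'm \<Rightarrow> 'm \<Rightarrow> bool" where
  "is_biproduct A X Y P i j p q \<longleftrightarrow> P \<in> Ob A \<and>
    i \<in> Hom A X P \<and> j \<in> Hom A Y P \<and> p \<in> Hom A P X \<and> q \<in> Hom A P Y \<and>
    p \<cdot>\<^bsub>A\<^esub> i = Idt A X \<and> q \<cdot>\<^bsub>A\<^esub> j = Idt A Y \<and>
    q \<cdot>\<^bsub>A\<^esub> i = Zero A X Y \<and> p \<cdot>\<^bsub>A\<^esub> j = Zero A Y X \<and>
    (i \<cdot>\<^bsub>A\<^esub> p) \<oplus>\<^bsub>A\<^esub> (j \<cdot>\<^bsub>A\<^esub> q) = Idt A P"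

locale additive_category = preadditive_category A for A :: "('o, 'm) preadditive_data" (structure) +
  assumes zero_object_exists: "\<exists>Z. is_zero_object A Z"
    and biproduct_exists: "\<lbrakk>X \<in> Ob A; Y \<in> Ob A\<rbrakk> \<Longrightarrow> \<exists>P i j p q. is_biproduct A X Y P i j p q"

definition is_kernel :: "('o, 'm) preadditive_data \<Rightarrow> 'm \<Rightarrow> 'm \<Rightarrow> bool" where
  "is_kernel A k f \<longleftrightarrow> k \<in> Ar A \<and> f \<in> Ar A \<and> Cod A k = Dom A f \<and>
    f \<cdot>\<^bsub>A\<^esub> k = Zero A (Dom A k) (Cod A f) \<and>
    (\<forall>u \<in> Ar A. Cod A u = Dom A f \<and> f \<cdot>\<^bsub>A\<^esub> u = Zero A (Dom A u) (Cod A f) \<longrightarrow>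
      (\<exists>!h. h \<in> Hom A (Dom A u) (Dom A k) \<and> k \<cdot>\<^bsub>A\<^esub> h = u))"

definition is_cokernel :: "('o, 'm) preadditive_data \<Rightarrow> 'm \<Rightarrow> 'm \<Rightarrow> bool" where
  "is_cokernel A c f \<longleftrightarrow> c \<in> Ar A \<and> f \<in> Ar A \<and> Dom A c = Cod A f \<and>
    c \<cdot>\<^bsub>A\<^esub> f = Zero A (Dom A f) (Cod A c) \<and>
    (\<forall>u \<in> Ar A. Dom A u = Cod A f \<and> u \<cdot>\<^bsub>A\<^esub> f = Zero A (Dom A f) (Cod A u) \<longrightarrow>
      (\<exists>!h. h \<in> Hom A (Cod A c) (Cod A u) \<and> h \<cdot>\<^bsub>A\<^esub> c = u))"

locale pre_abelian_category = additive_category A for A :: "('o, 'm) preadditive_data" (structure) +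
  assumes kernel_exists: "f \<in> Ar A \<Longrightarrow> \<exists>k. is_kernel A k f"
    and cokernel_exists: "f \<in> Ar A \<Longrightarrow> \<exists>c. is_cokernel A c f"

definition is_mono :: "('o, 'm) preadditive_data \<Rightarrow> 'm \<Rightarrow> bool" where
  "is_mono A f \<longleftrightarrow> f \<in> Ar A \<and>
    (\<forall>W u v. u \<in> Hom A W (Dom A f) \<and> v \<in> Hom A W (Dom A f) \<and> f \<cdot>\<^bsub>A\<^esub> u = f \<cdot>\<^bsub>A\<^esub> v \<longrightarrow> u = v)"

definition is_epi :: "('o, 'm) preadditive_data \<Rightarrow> 'm \<Rightarrow> bool" where
  "is_epi A f \<longleftrightarrow> f \<in> Ar A \<and>
    (\<forall>W u v. u \<in> Hom A (Cod A f) W \<and> v \<in> Hom A (Cod A f) W \<and> u \<cdot>\<^bsub>A\<^esub> f = v \<cdot>\<^bsub>A\<^esub> f \<longrightarrow> u = v)"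

definition is_iso :: "('o, 'm) preadditive_data \<Rightarrow> 'm \<Rightarrow> bool" where
  "is_iso A f \<longleftrightarrow> f \<in> Ar A \<and> (\<exists>g \<in> Hom A (Cod A f) (Dom A f).
    g \<cdot>\<^bsub>A\<^esub> f = Idt A (Dom A f) \<and> f \<cdot>\<^bsub>A\<^esub> g = Idt A (Cod A f))"

locale abelian_category = pre_abelian_category A for A :: "('o, 'm) preadditive_data" (structure) +
  assumes mono_is_kernel: "is_mono A f \<Longrightarrow> \<exists>g. is_kernel A f g"
    and epi_is_cokernel: "is_epi A f \<Longrightarrow> \<exists>g. is_cokernel A f g"

definition is_simple :: "('o, 'm) preadditive_data \<Rightarrow> 'o \<Rightarrow> bool" where
  "is_simple A S \<longleftrightarrow> S \<in> Ob A \<and> \<not> is_zero_object A S \<and>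
    (\<forall>f. is_mono A f \<and> Cod A f = S \<longrightarrow> is_zero_object A (Dom A f) \<or> is_iso A f)"

text \<open>
  \<open>M\<close> has finite length if it has a composition series: a chain of monomorphisms
  \<open>i k : X k \<longrightarrow> X (Suc k)\<close> for \<open>k < n\<close>, with simple cokernels, from a zero object to \<open>M\<close>.
\<close>

definition has_finite_length :: "('o, 'm) preadditive_data \<Rightarrow> 'o \<Rightarrow> bool" where
  "has_finite_length A M \<longleftrightarrow> (\<exists>(n::nat) X i. is_zero_object A (X 0) \<and> X n = M \<and>
    (\<forall>k<n. i k \<in> Hom A (X k) (X (Suc k)) \<and> is_mono A (i k) \<and>
      (\<exists>c. is_cokernel A c (i k) \<and> is_simple A (Cod A c))))"

locale abelian_length_category = abelian_category A for A :: "('o, 'm) preadditive_data" (structure) +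
  assumes finite_length: "M \<in> Ob A \<Longrightarrow> has_finite_length A M"

text \<open>Full subcategories are given by their sets of objects.\<close>

definition full_subcategory :: "('o, 'm) preadditive_data \<Rightarrow> 'o set \<Rightarrow> ('o, 'm) preadditive_data" where
  "full_subcategory A S =
    A\<lparr>Ob := Ob A \<inter> S, Ar := {f \<in> Ar A. Dom A f \<in> S \<and> Cod A f \<in> S}\<rparr>"

definition iso_closed :: "('o, 'm) preadditive_data \<Rightarrow> 'o set \<Rightarrow> bool" where
  "iso_closed A S \<longleftrightarrow> (\<forall>f. is_iso A f \<and> Dom A f \<in> S \<longrightarrow> Cod A f \<in> S)"

definition short_exact :: "('o, 'm) preadditive_data \<Rightarrow> 'm \<Rightarrow> 'm \<Rightarrow> bool" where
  "short_exact A f g \<longleftrightarrow> is_kernel A f g \<and> is_cokernel A g f"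

locale torsion_pair = pre_abelian_category A
  for A :: "('o, 'm) preadditive_data" (structure) and T :: "'o set" and F :: "'o set" +
  assumes torsion_objects: "T \<subseteq> Ob A"
    and torsion_free_objects: "F \<subseteq> Ob A"
    and torsion_iso_closed: "iso_closed A T"
    and torsion_free_iso_closed: "iso_closed A F"
    and hom_zero: "\<lbrakk>X \<in> T; Y \<in> F\<rbrakk> \<Longrightarrow> Hom A X Y = {Zero A X Y}"
    and torsion_sequence: "M \<in> Ob A \<Longrightarrow>
      \<exists>f g. short_exact A f g \<and> Dom A f \<in> T \<and> Cod A f = M \<and> Cod A g \<in> F"

definition torsion_class :: "('o, 'm) preadditive_data \<Rightarrow> 'o set \<Rightarrow> bool" where
  "torsion_class A T \<longleftrightarrow> (\<exists>F. torsion_pair A T F)"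

definition torsion_classes :: "('o, 'm) preadditive_data \<Rightarrow> 'o set gorder" where
  "torsion_classes A = \<lparr>carrier = {T. torsion_class A T}, eq = (=), le = (\<subseteq>)\<rparr>"

definition interval_lattice :: "'a gorder \<Rightarrow> 'a \<Rightarrow> 'a \<Rightarrow> 'a gorder" where
  "interval_lattice L a b = L\<lparr>carrier := \<lbrace>a..b\<rbrace>\<^bsub>L\<^esub>\<rparr>"

definition order_isomorphic :: "'a gorder \<Rightarrow> 'b gorder \<Rightarrow> bool" where
  "order_isomorphic L M \<longleftrightarrow> (\<exists>\<phi>. bij_betw \<phi> (carrier L) (carrier M) \<and> order_emb L M \<phi>)"

end

theory Submission
  imports Defs
begin

text \<open>
  Each half of a torsion pair \<open>(T, F)\<close> is the Hom-orthogonal of the other, so a torsion class has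
  the form \<open>left_perp A F = {X. Hom(X, Y) = 0 for all Y in F}\<close>. In a length category the converse
  holds for an arbitrary class \<open>F\<close> (\<open>left_perp_torsion_pair\<close>): \<open>left_perp A F\<close> is closed under
  quotients and extensions, and the ascending chain condition supplies a largest subobject of \<open>M\<close>
  in it, whose quotient has no nonzero map from \<open>left_perp A F\<close>. Torsion classes are therefore
  the closed sets of a Galois connection. They are stable under intersection, as
  \<open>left_perp\<close> turns unions into intersections, and form a complete lattice.

  Write \<open>B\<close> for the full subcategory on \<open>C' \<inter> D\<close>. It is pre-abelian: the kernel in \<open>B\<close> is the
  \<open>C'\<close>-torsion part of the kernel in \<open>A\<close>, the cokernel the \<open>D\<close>-torsion-free part of the cokernel.
  If \<open>(U, V)\<close> is a torsion pair with \<open>C \<subseteq> U \<subseteq> C'\<close>, its torsion sequences for objects of \<open>B\<close> stay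
  inside \<open>B\<close>, so \<open>(U \<inter> D, V \<inter> C')\<close> is a torsion pair in \<open>B\<close> (\<open>torsion_pair_restrict\<close>).
  The map \<open>U \<mapsto> U \<inter> D\<close> reflects inclusions (\<open>torsion_class_le_if_inter_le\<close>): an object of \<open>U\<close> is an
  extension of an object of \<open>U \<inter> D\<close> by an object of \<open>C\<close>. It is onto: for \<open>F \<subseteq> C' \<inter> D\<close> the
  torsion class \<open>left_perp A (F \<union> D') = left_perp A F \<inter> C'\<close> lies in the interval and meets
  \<open>D\<close> in the left orthogonal of \<open>F\<close> inside \<open>B\<close> (\<open>torsion_class_in_interval\<close>).

  The same computation shows that in \<open>B\<close> too every left orthogonal is a torsion class, although
  \<open>B\<close> is in general not abelian; hence the lattice argument applies to \<open>B\<close> verbatim.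
\<close>

section \<open>Arrows in preadditive categories\<close>

lemma HomD:
  assumes "f \<in> Hom A X Y"
  shows "f \<in> Ar A" "Dom A f = X" "Cod A f = Y"
  using assms by (auto simp: Hom_def)

lemma ArD: "f \<in> Ar A \<Longrightarrow> f \<in> Hom A (Dom A f) (Cod A f)"
  by (simp add: Hom_def)

context category
begin

lemma Hom_objects:
  assumes "f \<in> Hom A X Y"
  shows "X \<in> Ob A" "Y \<in> Ob A"
  using assms Dom_closed Cod_closed by (auto simp: Hom_def)

lemma monoD:
  assumes "is_mono A m" "m \<in> Hom A X Y" "u \<in> Hom A W X" "v \<in> Hom A W X" "m \<cdot> u = m \<cdot> v"
  shows "u = v"
  using assms unfolding is_mono_def by (metis HomD(2))

lemma epiD:
  assumes "is_epi A e" "e \<in> Hom A X Y" "u \<in> Hom A Y W" "v \<in> Hom A Y W" "u \<cdot> e = v \<cdot> e"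
  shows "u = v"
  using assms unfolding is_epi_def by (metis HomD(3))

lemma monoI:
  assumes "m \<in> Hom A X Y"
    and "\<And>W u v. \<lbrakk>u \<in> Hom A W X; v \<in> Hom A W X; m \<cdot> u = m \<cdot> v\<rbrakk> \<Longrightarrow> u = v"
  shows "is_mono A m"
  using assms unfolding is_mono_def by (metis HomD(1,2))

lemma epiI:
  assumes "e \<in> Hom A X Y"
    and "\<And>W u v. \<lbrakk>u \<in> Hom A Y W; v \<in> Hom A Y W; u \<cdot> e = v \<cdot> e\<rbrakk> \<Longrightarrow> u = v"
  shows "is_epi A e"
  using assms unfolding is_epi_def by (metis HomD(1,3))

lemma isoI:
  assumes "f \<in> Hom A X Y" "g \<in> Hom A Y X" "g \<cdot> f = Idt A X" "f \<cdot> g = Idt A Y"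
  shows "is_iso A f"
  using assms unfolding is_iso_def by (metis HomD)

lemma isoE:
  assumes "is_iso A f" "f \<in> Hom A X Y"
  obtains g where "g \<in> Hom A Y X" "g \<cdot> f = Idt A X" "f \<cdot> g = Idt A Y" "is_iso A g"
proof -
  obtain g where "g \<in> Hom A Y X" "g \<cdot> f = Idt A X" "f \<cdot> g = Idt A Y"
    using assms unfolding is_iso_def by (metis HomD(2,3))
  with isoI[OF this(1) assms(2)] that show thesis by blast
qed

lemma iso_mono: "is_iso A f \<Longrightarrow> is_mono A f"
proof -
  assume iso: "is_iso A f"
  then have f: "f \<in> Hom A (Dom A f) (Cod A f)" by (simp add: is_iso_def ArD)
  obtain g where g: "g \<in> Hom A (Cod A f) (Dom A f)" "g \<cdot> f = Idt A (Dom A f)"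
    using isoE[OF iso f] by blast
  show ?thesis
  proof (rule monoI[OF f])
    fix W u v assume uv: "u \<in> Hom A W (Dom A f)" "v \<in> Hom A W (Dom A f)" "f \<cdot> u = f \<cdot> v"
    have "u = (g \<cdot> f) \<cdot> u" using g uv Idt_Comp by simp
    also have "\<dots> = (g \<cdot> f) \<cdot> v" using Comp_assoc[OF uv(1) f g(1)] Comp_assoc[OF uv(2) f g(1)] uv by simp
    also have "\<dots> = v" using g uv Idt_Comp by simp
    finally show "u = v" .
  qed
qed

lemma iso_epi: "is_iso A f \<Longrightarrow> is_epi A f"
proof -
  assume iso: "is_iso A f"
  then have f: "f \<in> Hom A (Dom A f) (Cod A f)" by (simp add: is_iso_def ArD)
  obtain g where g: "g \<in> Hom A (Cod A f) (Dom A f)" "f \<cdot> g = Idt A (Cod A f)"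
    using isoE[OF iso f] by blast
  show ?thesis
  proof (rule epiI[OF f])
    fix W u v assume uv: "u \<in> Hom A (Cod A f) W" "v \<in> Hom A (Cod A f) W" "u \<cdot> f = v \<cdot> f"
    have "u = u \<cdot> (f \<cdot> g)" using g uv Comp_Idt by simp
    also have "\<dots> = v \<cdot> (f \<cdot> g)" using Comp_assoc[OF g(1) f uv(1)] Comp_assoc[OF g(1) f uv(2)] uv by simp
    also have "\<dots> = v" using g uv Comp_Idt by simp
    finally show "u = v" .
  qed
qed

lemma epi_comp:
  assumes "is_epi A e" "is_epi A d" "e \<in> Hom A X Y" "d \<in> Hom A Y Z"
  shows "is_epi A (d \<cdot> e)"
proof (rule epiI)
  show "d \<cdot> e \<in> Hom A X Z" using assms Comp_closed by blast
  fix W u v assume uv: "u \<in> Hom A Z W" "v \<in> Hom A Z W" "u \<cdot> (d \<cdot> e) = v \<cdot> (d \<cdot> e)"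
  then have "(u \<cdot> d) \<cdot> e = (v \<cdot> d) \<cdot> e" using Comp_assoc assms by metis
  then have "u \<cdot> d = v \<cdot> d" using epiD[OF assms(1,3)] uv assms Comp_closed by meson
  then show "u = v" using epiD[OF assms(2,4)] uv by blast
qed

lemma mono_comp:
  assumes "is_mono A e" "is_mono A d" "e \<in> Hom A X Y" "d \<in> Hom A Y Z"
  shows "is_mono A (d \<cdot> e)"
proof (rule monoI)
  show "d \<cdot> e \<in> Hom A X Z" using assms Comp_closed by blast
  fix W u v assume uv: "u \<in> Hom A W X" "v \<in> Hom A W X" "(d \<cdot> e) \<cdot> u = (d \<cdot> e) \<cdot> v"
  then have "d \<cdot> (e \<cdot> u) = d \<cdot> (e \<cdot> v)" using Comp_assoc assms by metis
  then have "e \<cdot> u = e \<cdot> v" using monoD[OF assms(2,4)] uv assms Comp_closed by meson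
  then show "u = v" using monoD[OF assms(1,3)] uv by blast
qed

lemma epi_cancel:
  assumes "is_epi A (d \<cdot> e)" "e \<in> Hom A X Y" "d \<in> Hom A Y Z"
  shows "is_epi A d"
proof (rule epiI[OF assms(3)])
  fix W u v assume uv: "u \<in> Hom A Z W" "v \<in> Hom A Z W" "u \<cdot> d = v \<cdot> d"
  then have "u \<cdot> (d \<cdot> e) = v \<cdot> (d \<cdot> e)"
    using Comp_assoc[OF assms(2,3) uv(1)] Comp_assoc[OF assms(2,3) uv(2)] by simp
  then show "u = v" using epiD[OF assms(1) Comp_closed[OF assms(2,3)]] uv by blast
qed

end

context preadditive_category
begin

lemma Zero_Hom:
  assumes "X \<in> Ob A" "Y \<in> Ob A"
  shows "Zero A X Y \<in> Hom A X Y"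
proof -
  interpret comm_group "hom_group A X Y" using hom_comm_group assms .
  show ?thesis using one_closed by (simp add: hom_group_def)
qed

lemma Add_Zero:
  assumes "f \<in> Hom A X Y"
  shows "f \<oplus> Zero A X Y = f" "Zero A X Y \<oplus> f = f"
proof -
  interpret comm_group "hom_group A X Y" using hom_comm_group Hom_objects[OF assms] .
  show "f \<oplus> Zero A X Y = f" "Zero A X Y \<oplus> f = f"
    using r_one l_one assms by (auto simp: hom_group_def)
qed

lemma Add_self_eq_Zero:
  assumes "f \<in> Hom A X Y" "f \<oplus> f = f"
  shows "f = Zero A X Y"
proof -
  interpret comm_group "hom_group A X Y" using hom_comm_group Hom_objects[OF assms(1)] .
  show ?thesis using l_cancel_one[of f f] assms by (simp add: hom_group_def)
qed

lemma difference_exists: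
  assumes "f \<in> Hom A X Y" "g \<in> Hom A X Y"
  obtains h where "h \<in> Hom A X Y" "h \<oplus> g = f"
proof -
  interpret comm_group "hom_group A X Y" using hom_comm_group Hom_objects[OF assms(1)] .
  have "g \<in> carrier (hom_group A X Y)" "f \<in> carrier (hom_group A X Y)"
    using assms by (simp_all add: hom_group_def)
  then have "f \<otimes>\<^bsub>hom_group A X Y\<^esub> inv\<^bsub>hom_group A X Y\<^esub> g \<in> carrier (hom_group A X Y)"
    "(f \<otimes>\<^bsub>hom_group A X Y\<^esub> inv\<^bsub>hom_group A X Y\<^esub> g) \<otimes>\<^bsub>hom_group A X Y\<^esub> g = f"
    by (simp_all add: m_assoc)
  with that show thesis by (simp add: hom_group_def)
qed

lemma Add_left_cancel_Zero:
  assumes "f \<in> Hom A X Y" "g \<in> Hom A X Y" "h \<oplus> g = g" "h \<in> Hom A X Y"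
  shows "h = Zero A X Y"
proof -
  interpret comm_group "hom_group A X Y" using hom_comm_group Hom_objects[OF assms(1)] .
  show ?thesis using r_cancel_one[of g h] assms by (simp add: hom_group_def)
qed

lemma Comp_Zero:
  assumes "g \<in> Hom A Y Z" "X \<in> Ob A"
  shows "g \<cdot> Zero A X Y = Zero A X Z"
proof -
  have z: "Zero A X Y \<in> Hom A X Y" using Zero_Hom assms Hom_objects by blast
  have "g \<cdot> Zero A X Y \<oplus> g \<cdot> Zero A X Y = g \<cdot> Zero A X Y"
    using Add_Comp[OF z z assms(1)] Add_Zero[OF z] by simp
  then show ?thesis using Add_self_eq_Zero Comp_closed[OF z assms(1)] by blast
qed

lemma Zero_Comp:
  assumes "f \<in> Hom A X Y" "Z \<in> Ob A"
  shows "Zero A Y Z \<cdot> f = Zero A X Z"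
proof -
  have z: "Zero A Y Z \<in> Hom A Y Z" using Zero_Hom assms Hom_objects by blast
  have "Zero A Y Z \<cdot> f \<oplus> Zero A Y Z \<cdot> f = Zero A Y Z \<cdot> f"
    using Comp_Add[OF assms(1) z z] Add_Zero[OF z] by simp
  then show ?thesis using Add_self_eq_Zero Comp_closed[OF assms(1) z] by blast
qed

lemma mono_ZeroI:
  assumes m: "m \<in> Hom A X Y"
    and zero: "\<And>W u. \<lbrakk>u \<in> Hom A W X; m \<cdot> u = Zero A W Y\<rbrakk> \<Longrightarrow> u = Zero A W X"
  shows "is_mono A m"
proof (rule monoI[OF m])
  fix W u v assume uv: "u \<in> Hom A W X" "v \<in> Hom A W X" "m \<cdot> u = m \<cdot> v"
  obtain d where d: "d \<in> Hom A W X" "d \<oplus> v = u" using difference_exists uv by blast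
  have "m \<cdot> d \<oplus> m \<cdot> v = m \<cdot> v" using Add_Comp[OF d(1) uv(2) m] d uv by simp
  then have "d = Zero A W X" using zero d Add_left_cancel_Zero Comp_closed m uv by metis
  then show "u = v" using d Add_Zero uv by blast
qed

lemma epi_ZeroI:
  assumes e: "e \<in> Hom A X Y"
    and zero: "\<And>W u. \<lbrakk>u \<in> Hom A Y W; u \<cdot> e = Zero A X W\<rbrakk> \<Longrightarrow> u = Zero A Y W"
  shows "is_epi A e"
proof (rule epiI[OF e])
  fix W u v assume uv: "u \<in> Hom A Y W" "v \<in> Hom A Y W" "u \<cdot> e = v \<cdot> e"
  obtain d where d: "d \<in> Hom A Y W" "d \<oplus> v = u" using difference_exists uv by blast
  have "d \<cdot> e \<oplus> v \<cdot> e = v \<cdot> e" using Comp_Add[OF e d(1) uv(2)] d uv by simp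
  then have "d = Zero A Y W" using zero d Add_left_cancel_Zero Comp_closed e uv by metis
  then show "u = v" using d Add_Zero uv by blast
qed

lemma mono_Zero_cancel:
  assumes "is_mono A m" "m \<in> Hom A X Y" "u \<in> Hom A W X" "m \<cdot> u = Zero A W Y"
  shows "u = Zero A W X"
  using monoD[OF assms(1-3)] assms Comp_Zero Zero_Hom Hom_objects by metis

lemma epi_Zero_cancel:
  assumes "is_epi A e" "e \<in> Hom A X Y" "u \<in> Hom A Y W" "u \<cdot> e = Zero A X W"
  shows "u = Zero A Y W"
  using epiD[OF assms(1-3)] assms Zero_Comp Zero_Hom Hom_objects by metis

lemma kernel_Zero:
  assumes "is_kernel A k f" "k \<in> Hom A K X" "f \<in> Hom A X Y"
  shows "f \<cdot> k = Zero A K Y"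
  using assms unfolding is_kernel_def by (metis HomD)

lemma kernel_lift:
  assumes "is_kernel A k f" "k \<in> Hom A K X" "f \<in> Hom A X Y"
    and "u \<in> Hom A W X" "f \<cdot> u = Zero A W Y"
  obtains h where "h \<in> Hom A W K" "k \<cdot> h = u"
  using assms unfolding is_kernel_def by (metis HomD)

lemma cokernel_Zero:
  assumes "is_cokernel A c f" "c \<in> Hom A Y Q" "f \<in> Hom A X Y"
  shows "c \<cdot> f = Zero A X Q"
  using assms unfolding is_cokernel_def by (metis HomD)

lemma cokernel_desc:
  assumes "is_cokernel A c f" "c \<in> Hom A Y Q" "f \<in> Hom A X Y"
    and "u \<in> Hom A Y W" "u \<cdot> f = Zero A X W"
  obtains h where "h \<in> Hom A Q W" "h \<cdot> c = u"
  using assms unfolding is_cokernel_def by (metis HomD)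

lemma kernel_mono:
  assumes "is_kernel A k f"
  shows "is_mono A k"
proof -
  have k: "k \<in> Hom A (Dom A k) (Dom A f)" and f: "f \<in> Hom A (Dom A f) (Cod A f)"
    using assms by (auto simp: is_kernel_def Hom_def)
  show ?thesis
  proof (rule monoI[OF k])
    fix W u v assume uv: "u \<in> Hom A W (Dom A k)" "v \<in> Hom A W (Dom A k)" "k \<cdot> u = k \<cdot> v"
    have ku: "k \<cdot> u \<in> Hom A W (Dom A f)" using uv k Comp_closed by blast
    have "f \<cdot> (k \<cdot> u) = Zero A W (Cod A f)"
      using Comp_assoc[OF uv(1) k f] kernel_Zero[OF assms k f] Zero_Comp[OF uv(1)] Hom_objects[OF f]
      by simp
    then have "f \<cdot> (k \<cdot> u) = Zero A (Dom A (k \<cdot> u)) (Cod A f)" using HomD[OF ku] by simp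
    then have "\<exists>!h. h \<in> Hom A (Dom A (k \<cdot> u)) (Dom A k) \<and> k \<cdot> h = k \<cdot> u"
      using assms HomD[OF ku] unfolding is_kernel_def by blast
    with uv HomD[OF ku] show "u = v" by metis
  qed
qed

lemma cokernel_epi:
  assumes "is_cokernel A c f"
  shows "is_epi A c"
proof -
  have c: "c \<in> Hom A (Cod A f) (Cod A c)" and f: "f \<in> Hom A (Dom A f) (Cod A f)"
    using assms by (auto simp: is_cokernel_def Hom_def)
  show ?thesis
  proof (rule epiI[OF c])
    fix W u v assume uv: "u \<in> Hom A (Cod A c) W" "v \<in> Hom A (Cod A c) W" "u \<cdot> c = v \<cdot> c"
    have uc: "u \<cdot> c \<in> Hom A (Cod A f) W" using uv c Comp_closed by blast
    have "(u \<cdot> c) \<cdot> f = Zero A (Dom A f) W"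
      using Comp_assoc[OF f c uv(1)] cokernel_Zero[OF assms c f] Comp_Zero[OF uv(1)] Hom_objects[OF f]
      by simp
    then have "(u \<cdot> c) \<cdot> f = Zero A (Dom A f) (Cod A (u \<cdot> c))" using HomD[OF uc] by simp
    then have "\<exists>!h. h \<in> Hom A (Cod A c) (Cod A (u \<cdot> c)) \<and> h \<cdot> c = u \<cdot> c"
      using assms HomD[OF uc] unfolding is_cokernel_def by blast
    with uv HomD[OF uc] show "u = v" by metis
  qed
qed

text \<open>
  Uniqueness of the lift is traded for \<open>k\<close> being mono, which is usually known beforehand.
\<close>

lemma kernelI:
  assumes k: "k \<in> Hom A K X" and f: "f \<in> Hom A X Y" and "is_mono A k" and "f \<cdot> k = Zero A K Y"
    and lift: "\<And>W u. \<lbrakk>u \<in> Hom A W X; f \<cdot> u = Zero A W Y\<rbrakk> \<Longrightarrow> \<exists>h \<in> Hom A W K. k \<cdot> h = u"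
  shows "is_kernel A k f"
  unfolding is_kernel_def
proof (intro conjI ballI impI)
  fix u assume "u \<in> Ar A" "Cod A u = Dom A f \<and> f \<cdot> u = Zero A (Dom A u) (Cod A f)"
  then obtain h where "h \<in> Hom A (Dom A u) K" "k \<cdot> h = u"
    using lift[of u "Dom A u"] HomD[OF f] by (auto simp: Hom_def)
  then show "\<exists>!h. h \<in> Hom A (Dom A u) (Dom A k) \<and> k \<cdot> h = u"
    using monoD[OF assms(3) k] HomD[OF k] by metis
qed (use assms HomD[OF k] HomD[OF f] in simp_all)

lemma cokernelI:
  assumes c: "c \<in> Hom A Y Q" and f: "f \<in> Hom A X Y" and "is_epi A c" and "c \<cdot> f = Zero A X Q"
    and desc: "\<And>W u. \<lbrakk>u \<in> Hom A Y W; u \<cdot> f = Zero A X W\<rbrakk> \<Longrightarrow> \<exists>h \<in> Hom A Q W. h \<cdot> c = u"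
  shows "is_cokernel A c f"
  unfolding is_cokernel_def
proof (intro conjI ballI impI)
  fix u assume "u \<in> Ar A" "Dom A u = Cod A f \<and> u \<cdot> f = Zero A (Dom A f) (Cod A u)"
  then obtain h where "h \<in> Hom A Q (Cod A u)" "h \<cdot> c = u"
    using desc[of u "Cod A u"] HomD[OF f] by (auto simp: Hom_def)
  then show "\<exists>!h. h \<in> Hom A (Cod A c) (Cod A u) \<and> h \<cdot> c = u"
    using epiD[OF assms(3) c] HomD[OF c] by metis
qed (use assms HomD[OF c] HomD[OF f] in simp_all)

lemma kernel_of_Zero_iso:
  assumes "is_kernel A k (Zero A X Y)" "k \<in> Hom A K X" "Y \<in> Ob A"
  shows "is_iso A k"
proof -
  have X: "X \<in> Ob A" using assms Hom_objects by blast
  note z = Zero_Hom[OF X assms(3)]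
  obtain h where h: "h \<in> Hom A X K" "k \<cdot> h = Idt A X"
    using kernel_lift[OF assms(1,2) z Idt_closed[OF X]] Comp_Idt[OF z] by blast
  have "k \<cdot> (h \<cdot> k) = k \<cdot> Idt A K"
    using Comp_assoc[OF assms(2) h(1) assms(2)] h Idt_Comp Comp_Idt assms by simp
  then have "h \<cdot> k = Idt A K"
    using monoD[OF kernel_mono[OF assms(1)] assms(2)] Comp_closed h assms Idt_closed Hom_objects
    by meson
  with h isoI[OF assms(2)] show ?thesis by blast
qed

lemma cokernel_of_Zero_iso:
  assumes "is_cokernel A c (Zero A X Y)" "c \<in> Hom A Y Q" "X \<in> Ob A"
  shows "is_iso A c"
proof -
  have Y: "Y \<in> Ob A" using assms Hom_objects by blast
  note z = Zero_Hom[OF assms(3) Y]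
  obtain h where h: "h \<in> Hom A Q Y" "h \<cdot> c = Idt A Y"
    using cokernel_desc[OF assms(1,2) z Idt_closed[OF Y]] Idt_Comp[OF z] by blast
  have "(c \<cdot> h) \<cdot> c = Idt A Q \<cdot> c"
    using Comp_assoc[OF assms(2) h(1) assms(2)] h Idt_Comp Comp_Idt assms by simp
  then have "c \<cdot> h = Idt A Q"
    using epiD[OF cokernel_epi[OF assms(1)] assms(2)] Comp_closed h assms Idt_closed Hom_objects
    by meson
  with h isoI[OF assms(2)] show ?thesis by blast
qed

text \<open>
  The equational form is inherited by every full subcategory that contains \<open>Z\<close>, unlike the
  universal property, which quantifies over the objects of the category.
\<close>

lemma zero_object_iff: "is_zero_object A Z \<longleftrightarrow> Z \<in> Ob A \<and> Idt A Z = Zero A Z Z"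
proof
  assume "is_zero_object A Z"
  then show "Z \<in> Ob A \<and> Idt A Z = Zero A Z Z"
    unfolding is_zero_object_def using Idt_closed Zero_Hom by metis
next
  assume Z: "Z \<in> Ob A \<and> Idt A Z = Zero A Z Z"
  have "f = Zero A X Z" if "f \<in> Hom A X Z" for f X
    using that Z Idt_Comp Zero_Comp by metis
  moreover have "f = Zero A Z X" if "f \<in> Hom A Z X" for f X
    using that Z Comp_Idt Comp_Zero by metis
  ultimately show "is_zero_object A Z"
    unfolding is_zero_object_def using Z Zero_Hom by metis
qed

lemma zero_object_Hom:
  assumes "is_zero_object A Z"
  shows "f \<in> Hom A X Z \<Longrightarrow> f = Zero A X Z" "f \<in> Hom A Z X \<Longrightarrow> f = Zero A Z X"
  using assms zero_object_iff Idt_Comp Zero_Comp Comp_Idt Comp_Zero by metis+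

lemma mono_from_zero_object:
  assumes "f \<in> Hom A Z X" "is_zero_object A Z"
  shows "is_mono A f"
  using assms mono_ZeroI zero_object_Hom by metis

end

section \<open>Hom-orthogonal classes and torsion pairs\<close>

definition left_perp :: "('o, 'm) preadditive_data \<Rightarrow> 'o set \<Rightarrow> 'o set" where
  "left_perp A F = {X \<in> Ob A. \<forall>Y \<in> F. Hom A X Y \<subseteq> {Zero A X Y}}"

definition right_perp :: "('o, 'm) preadditive_data \<Rightarrow> 'o set \<Rightarrow> 'o set" where
  "right_perp A T = {Y \<in> Ob A. \<forall>X \<in> T. Hom A X Y \<subseteq> {Zero A X Y}}"

lemma left_perpD: "\<lbrakk>X \<in> left_perp A F; Y \<in> F; f \<in> Hom A X Y\<rbrakk> \<Longrightarrow> f = Zero A X Y"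
  unfolding left_perp_def by blast

lemma right_perpD: "\<lbrakk>Y \<in> right_perp A T; X \<in> T; f \<in> Hom A X Y\<rbrakk> \<Longrightarrow> f = Zero A X Y"
  unfolding right_perp_def by blast

lemma left_perp_objects: "X \<in> left_perp A F \<Longrightarrow> X \<in> Ob A"
  by (simp add: left_perp_def)

lemma right_perp_objects: "Y \<in> right_perp A T \<Longrightarrow> Y \<in> Ob A"
  by (simp add: right_perp_def)

lemma left_perpI:
  "\<lbrakk>X \<in> Ob A; \<And>Y f. \<lbrakk>Y \<in> F; f \<in> Hom A X Y\<rbrakk> \<Longrightarrow> f = Zero A X Y\<rbrakk> \<Longrightarrow> X \<in> left_perp A F"
  unfolding left_perp_def by blast

lemma right_perpI:
  "\<lbrakk>Y \<in> Ob A; \<And>X f. \<lbrakk>X \<in> T; f \<in> Hom A X Y\<rbrakk> \<Longrightarrow> f = Zero A X Y\<rbrakk> \<Longrightarrow> Y \<in> right_perp A T"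
  unfolding right_perp_def by blast

lemma left_perp_antimono: "F \<subseteq> F' \<Longrightarrow> left_perp A F' \<subseteq> left_perp A F"
  unfolding left_perp_def by blast

lemma right_perp_antimono: "T \<subseteq> T' \<Longrightarrow> right_perp A T' \<subseteq> right_perp A T"
  unfolding right_perp_def by blast

lemma left_perp_Un: "left_perp A (F \<union> F') = left_perp A F \<inter> left_perp A F'"
  unfolding left_perp_def by blast

lemma short_exactE:
  assumes "short_exact A f g"
  obtains X Y Z where "f \<in> Hom A X Y" "g \<in> Hom A Y Z" "is_kernel A f g" "is_cokernel A g f"
    "X = Dom A f" "Y = Cod A f" "Z = Cod A g"
  using assms unfolding short_exact_def is_kernel_def Hom_def by auto

context preadditive_category
begin

lemma left_perp_epi:
  assumes "X \<in> left_perp A F" "is_epi A e" "e \<in> Hom A X Y"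
  shows "Y \<in> left_perp A F"
proof (rule left_perpI)
  show "Y \<in> Ob A" using assms Hom_objects by blast
  fix W f assume f: "W \<in> F" "f \<in> Hom A Y W"
  then have "f \<cdot> e = Zero A X W" using left_perpD[OF assms(1)] Comp_closed assms by blast
  then show "f = Zero A Y W" using epi_Zero_cancel assms f by blast
qed

lemma right_perp_mono:
  assumes "Y \<in> right_perp A T" "is_mono A m" "m \<in> Hom A X Y"
  shows "X \<in> right_perp A T"
proof (rule right_perpI)
  show "X \<in> Ob A" using assms Hom_objects by blast
  fix W f assume f: "W \<in> T" "f \<in> Hom A W X"
  then have "m \<cdot> f = Zero A W Y" using right_perpD[OF assms(1)] Comp_closed assms by blast
  then show "f = Zero A W X" using mono_Zero_cancel assms f by blast
qed

text \<open>
  A map from \<open>Y\<close> to an object of \<open>F\<close> vanishes on \<open>X\<close>, so it factors through \<open>Z\<close>, where it is zero.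
\<close>

lemma left_perp_extension:
  assumes "X \<in> left_perp A F" "Z \<in> left_perp A F"
    and "is_cokernel A g f" "f \<in> Hom A X Y" "g \<in> Hom A Y Z"
  shows "Y \<in> left_perp A F"
proof (rule left_perpI)
  show "Y \<in> Ob A" using assms Hom_objects by blast
  fix W u assume u: "W \<in> F" "u \<in> Hom A Y W"
  then have "u \<cdot> f = Zero A X W" using left_perpD[OF assms(1)] Comp_closed assms by blast
  then obtain h where "h \<in> Hom A Z W" "h \<cdot> g = u"
    using cokernel_desc[OF assms(3,5,4) u(2)] by blast
  then show "u = Zero A Y W"
    using left_perpD[OF assms(2) u(1)] Zero_Comp[OF assms(5)] Hom_objects u by metis
qed

lemma left_perp_zero_object: "is_zero_object A Z \<Longrightarrow> Z \<in> left_perp A F"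
  using left_perpI zero_object_Hom zero_object_iff by metis

lemma right_perp_zero_object: "is_zero_object A Z \<Longrightarrow> Z \<in> right_perp A T"
  using right_perpI zero_object_Hom zero_object_iff by metis

lemma left_perp_biproduct:
  assumes "is_biproduct A X Y P i j p q" "X \<in> left_perp A F" "Y \<in> left_perp A F"
  shows "P \<in> left_perp A F"
proof (rule left_perpI)
  have P: "P \<in> Ob A" "i \<in> Hom A X P" "j \<in> Hom A Y P" "p \<in> Hom A P X" "q \<in> Hom A P Y"
    "(i \<cdot> p) \<oplus> (j \<cdot> q) = Idt A P"
    using assms(1) by (auto simp: is_biproduct_def)
  then show "P \<in> Ob A" by simp
  fix W f assume f: "W \<in> F" "f \<in> Hom A P W"
  then have W: "W \<in> Ob A" using Hom_objects by blast
  have "f \<cdot> i = Zero A X W" "f \<cdot> j = Zero A Y W"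
    using left_perpD[OF assms(2) f(1) Comp_closed[OF P(2) f(2)]]
      left_perpD[OF assms(3) f(1) Comp_closed[OF P(3) f(2)]] by auto
  then have "f \<cdot> (i \<cdot> p) = Zero A P W" "f \<cdot> (j \<cdot> q) = Zero A P W"
    using Comp_assoc[OF P(4,2) f(2)] Comp_assoc[OF P(5,3) f(2)]
      Zero_Comp[OF P(4) W] Zero_Comp[OF P(5) W] by simp_all
  then have "f \<cdot> Idt A P = Zero A P W"
    using Add_Comp[OF Comp_closed[OF P(4,2)] Comp_closed[OF P(5,3)] f(2)]
      Add_Zero Zero_Hom P(1,6) W by simp
  then show "f = Zero A P W" using Comp_Idt f by simp
qed

lemma right_perp_biproduct:
  assumes "is_biproduct A X Y P i j p q" "X \<in> right_perp A T" "Y \<in> right_perp A T"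
  shows "P \<in> right_perp A T"
proof (rule right_perpI)
  have P: "P \<in> Ob A" "i \<in> Hom A X P" "j \<in> Hom A Y P" "p \<in> Hom A P X" "q \<in> Hom A P Y"
    "(i \<cdot> p) \<oplus> (j \<cdot> q) = Idt A P"
    using assms(1) by (auto simp: is_biproduct_def)
  then show "P \<in> Ob A" by simp
  fix W f assume f: "W \<in> T" "f \<in> Hom A W P"
  then have W: "W \<in> Ob A" using Hom_objects by blast
  have "p \<cdot> f = Zero A W X" "q \<cdot> f = Zero A W Y"
    using right_perpD[OF assms(2) f(1) Comp_closed[OF f(2) P(4)]]
      right_perpD[OF assms(3) f(1) Comp_closed[OF f(2) P(5)]] by auto
  then have "(i \<cdot> p) \<cdot> f = Zero A W P" "(j \<cdot> q) \<cdot> f = Zero A W P"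
    using Comp_assoc[OF f(2) P(4,2)] Comp_assoc[OF f(2) P(5,3)]
      Comp_Zero[OF P(2) W] Comp_Zero[OF P(3) W] by simp_all
  then have "Idt A P \<cdot> f = Zero A W P"
    using Comp_Add[OF f(2) Comp_closed[OF P(4,2)] Comp_closed[OF P(5,3)]]
      Add_Zero Zero_Hom P(1,6) W by simp
  then show "f = Zero A W P" using Idt_Comp f by simp
qed

end

context torsion_pair
begin

lemma torsion_sequenceE:
  assumes "M \<in> Ob A"
  obtains X Z f g where "X \<in> T" "Z \<in> F" "f \<in> Hom A X M" "g \<in> Hom A M Z"
    "is_kernel A f g" "is_cokernel A g f"
  using torsion_sequence[OF assms] short_exactE by metis

text \<open>
  If \<open>M\<close> has no nonzero map to \<open>F\<close>, the second arrow of its torsion sequence is zero, so the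
  inclusion of the torsion part is an isomorphism.
\<close>

lemma torsion_eq_left_perp: "T = left_perp A F"
proof
  show "T \<subseteq> left_perp A F" using torsion_objects hom_zero by (auto simp: left_perp_def)
  show "left_perp A F \<subseteq> T"
  proof
    fix M assume M: "M \<in> left_perp A F"
    obtain X Z f g where s: "X \<in> T" "Z \<in> F" "f \<in> Hom A X M" "g \<in> Hom A M Z"
      "is_kernel A f g" "is_cokernel A g f"
      using torsion_sequenceE[OF left_perp_objects[OF M]] by blast
    have "g = Zero A M Z" using left_perpD M s by metis
    then have "is_iso A f" using kernel_of_Zero_iso s torsion_free_objects by blast
    then show "M \<in> T" using torsion_iso_closed s HomD[OF s(3)] by (auto simp: iso_closed_def)
  qed
qed

lemma torsion_free_eq_right_perp: "F = right_perp A T"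
proof
  show "F \<subseteq> right_perp A T" using torsion_free_objects hom_zero by (auto simp: right_perp_def)
  show "right_perp A T \<subseteq> F"
  proof
    fix M assume M: "M \<in> right_perp A T"
    obtain X Z f g where s: "X \<in> T" "Z \<in> F" "f \<in> Hom A X M" "g \<in> Hom A M Z"
      "is_kernel A f g" "is_cokernel A g f"
      using torsion_sequenceE[OF right_perp_objects[OF M]] by blast
    have "f = Zero A X M" using right_perpD M s by metis
    then have "is_iso A g" using cokernel_of_Zero_iso s torsion_objects by blast
    then obtain h where "h \<in> Hom A Z M" "is_iso A h" using isoE s by metis
    then show "M \<in> F" using torsion_free_iso_closed s HomD by (metis iso_closed_def)
  qed
qed

end

text \<open>
  For a pair of mutually orthogonal classes, only the existence of torsion sequences remains to be
  checked; orthogonals are closed under isomorphism automatically.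
\<close>

lemma (in pre_abelian_category) torsion_pairI:
  assumes T: "T = left_perp A F'" and F: "F = right_perp A T"
    and seq: "\<And>M. M \<in> Ob A \<Longrightarrow> \<exists>X Z f g. X \<in> T \<and> Z \<in> F \<and> f \<in> Hom A X M \<and> g \<in> Hom A M Z
      \<and> is_kernel A f g \<and> is_cokernel A g f"
  shows "torsion_pair A T F"
proof
  show "T \<subseteq> Ob A" "F \<subseteq> Ob A" using assms by (auto simp: left_perp_def right_perp_def)
  show "iso_closed A T"
    unfolding iso_closed_def T using left_perp_epi iso_epi ArD by (metis is_iso_def)
  show "iso_closed A F"
    unfolding iso_closed_def
  proof (intro allI impI)
    fix f assume f: "is_iso A f \<and> Dom A f \<in> F"
    then obtain g where "g \<in> Hom A (Cod A f) (Dom A f)" "is_iso A g"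
      using isoE ArD by (metis is_iso_def)
    with f show "Cod A f \<in> F" unfolding F using right_perp_mono iso_mono by blast
  qed
  fix X Y assume XY: "X \<in> T" "Y \<in> F"
  then have "Zero A X Y \<in> Hom A X Y" using Zero_Hom \<open>T \<subseteq> Ob A\<close> \<open>F \<subseteq> Ob A\<close> by blast
  moreover have "Hom A X Y \<subseteq> {Zero A X Y}" using XY unfolding F right_perp_def by blast
  ultimately show "Hom A X Y = {Zero A X Y}" by blast
next
  fix M assume "M \<in> Ob A"
  from seq[OF this] obtain X Z f g where "X \<in> T \<and> Z \<in> F \<and> f \<in> Hom A X M \<and> g \<in> Hom A M Z
      \<and> is_kernel A f g \<and> is_cokernel A g f" by blast
  then show "\<exists>f g. short_exact A f g \<and> Dom A f \<in> T \<and> Cod A f = M \<and> Cod A g \<in> F"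
    unfolding short_exact_def by (metis HomD(2,3))
qed

section \<open>The full subcategory cut out by two torsion pairs\<close>

lemma full_subcategory_simps [simp]:
  "Ob (full_subcategory A S) = Ob A \<inter> S"
  "Dom (full_subcategory A S) = Dom A"
  "Cod (full_subcategory A S) = Cod A"
  "Idt (full_subcategory A S) = Idt A"
  "Comp (full_subcategory A S) = Comp A"
  "Add (full_subcategory A S) = Add A"
  "Zero (full_subcategory A S) = Zero A"
  by (simp_all add: full_subcategory_def)

lemma Hom_full_subcategory:
  "Hom (full_subcategory A S) X Y = (if X \<in> S \<and> Y \<in> S then Hom A X Y else {})"
  by (auto simp: full_subcategory_def Hom_def)

lemma Hom_full_subcategoryD:
  assumes "f \<in> Hom (full_subcategory A S) X Y"
  shows "f \<in> Hom A X Y" "X \<in> S" "Y \<in> S"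
  using assms by (auto simp: Hom_full_subcategory split: if_splits)

lemma left_perp_full_subcategory:
  assumes "F \<subseteq> S"
  shows "left_perp (full_subcategory A S) F = S \<inter> left_perp A F"
  using assms by (auto simp: left_perp_def Hom_full_subcategory split: if_splits)

lemma Ar_full_subcategory: "f \<in> Ar (full_subcategory A S) \<longleftrightarrow> f \<in> Ar A \<and> Dom A f \<in> S \<and> Cod A f \<in> S"
  by (simp add: full_subcategory_def)

lemma mono_full_subcategory:
  assumes "is_mono A f" "Dom A f \<in> S" "Cod A f \<in> S"
  shows "is_mono (full_subcategory A S) f"
  using assms by (auto simp: is_mono_def Ar_full_subcategory dest!: Hom_full_subcategoryD(1))

lemma epi_full_subcategory:
  assumes "is_epi A f" "Dom A f \<in> S" "Cod A f \<in> S"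
  shows "is_epi (full_subcategory A S) f"
  using assms by (auto simp: is_epi_def Ar_full_subcategory dest!: Hom_full_subcategoryD(1))

text \<open>
  A universal property that ranges over all of \<open>A\<close> holds a fortiori when it is tested on fewer
  objects. Conversely, a kernel in the subcategory need not be one in \<open>A\<close>.
\<close>

lemma kernel_full_subcategory:
  assumes "is_kernel A k f" "Dom A k \<in> S" "Dom A f \<in> S" "Cod A f \<in> S"
  shows "is_kernel (full_subcategory A S) k f"
  using assms by (auto simp: is_kernel_def Ar_full_subcategory Hom_full_subcategory)

lemma cokernel_full_subcategory:
  assumes "is_cokernel A c f" "Cod A c \<in> S" "Dom A f \<in> S" "Cod A f \<in> S"
  shows "is_cokernel (full_subcategory A S) c f"
  using assms by (auto simp: is_cokernel_def Ar_full_subcategory Hom_full_subcategory)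

lemma (in preadditive_category) preadditive_full_subcategory:
  "preadditive_category (full_subcategory A S)"
proof (intro preadditive_category.intro category.intro preadditive_category_axioms.intro)
  fix f assume "f \<in> Ar (full_subcategory A S)"
  then show "Dom (full_subcategory A S) f \<in> Ob (full_subcategory A S)"
    "Cod (full_subcategory A S) f \<in> Ob (full_subcategory A S)"
    by (auto simp: Ar_full_subcategory Dom_closed Cod_closed)
next
  fix X Y assume "X \<in> Ob (full_subcategory A S)" "Y \<in> Ob (full_subcategory A S)"
  then show "comm_group (hom_group (full_subcategory A S) X Y)"
    using hom_comm_group[of X Y] by (simp add: hom_group_def Hom_full_subcategory)
qed (auto simp: Hom_full_subcategory split: if_splits
    intro: Idt_closed Comp_closed Comp_Idt Idt_Comp Comp_assoc Comp_Add Add_Comp)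

text \<open>
  Let \<open>f\<close> be an arrow of the subcategory and \<open>K\<close> its kernel in \<open>A\<close>. As a subobject of an object
  of \<open>D\<close>, \<open>K\<close> is in \<open>D\<close>, but it may fail to be in \<open>C'\<close>. Its \<open>C'\<close>-torsion part \<open>L\<close> lies in both,
  and it still is a kernel with respect to test objects \<open>W\<close> in \<open>C'\<close>, since the composite
  \<open>W \<rightarrow> K \<rightarrow> K/L\<close> vanishes. Cokernels are dual, with the torsion-free quotient for \<open>(C, D)\<close>.
\<close>

lemma (in pre_abelian_category) pre_abelian_full_subcategory:
  assumes "torsion_pair A C D" "torsion_pair A C' D'"
  shows "pre_abelian_category (full_subcategory A (C' \<inter> D))" (is "pre_abelian_category ?B")
proof -
  interpret t: torsion_pair A C D by fact
  interpret t': torsion_pair A C' D' by fact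
  interpret B: preadditive_category ?B by (rule preadditive_full_subcategory)
  note C' = t'.torsion_eq_left_perp and D = t.torsion_free_eq_right_perp
  have C'_epi: "Y \<in> C'" if "X \<in> C'" "is_epi A e" "e \<in> Hom A X Y" for X Y e
    using that left_perp_epi unfolding C' by blast
  have D_mono: "X \<in> D" if "Y \<in> D" "is_mono A m" "m \<in> Hom A X Y" for X Y m
    using that right_perp_mono unfolding D by blast
  show ?thesis
  proof
    obtain Z where Z: "is_zero_object A Z" using zero_object_exists by blast
    then have "Z \<in> C' \<inter> D"
      using left_perp_zero_object right_perp_zero_object unfolding C' D by blast
    with Z have "is_zero_object ?B Z" by (simp add: zero_object_iff B.zero_object_iff)
    then show "\<exists>Z. is_zero_object ?B Z" by blast
  next
    fix X Y assume "X \<in> Ob ?B" "Y \<in> Ob ?B"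
    then have XY: "X \<in> Ob A" "Y \<in> Ob A" "X \<in> C' \<inter> D" "Y \<in> C' \<inter> D" by auto
    obtain P i j p q where P: "is_biproduct A X Y P i j p q"
      using biproduct_exists[OF XY(1,2)] by blast
    then have "P \<in> C' \<inter> D"
      using left_perp_biproduct[OF P] right_perp_biproduct[OF P] XY unfolding C' D by blast
    with P XY have "is_biproduct ?B X Y P i j p q"
      by (simp add: is_biproduct_def Hom_full_subcategory)
    then show "\<exists>P i j p q. is_biproduct ?B X Y P i j p q" by blast
  next
    fix f assume "f \<in> Ar ?B"
    then obtain X Y where f: "f \<in> Hom A X Y" "X \<in> C' \<inter> D" "Y \<in> C' \<inter> D"
      by (auto simp: Ar_full_subcategory Hom_def)
    obtain k K where k: "is_kernel A k f" "k \<in> Hom A K X"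
      using kernel_exists[OF HomD(1)[OF f(1)]] HomD[OF f(1)]
      by (metis ArD is_kernel_def)
    obtain L Q l g where L: "L \<in> C'" "Q \<in> D'" "l \<in> Hom A L K" "g \<in> Hom A K Q"
      "is_kernel A l g" "is_cokernel A g l"
      using t'.torsion_sequenceE Hom_objects(1)[OF k(2)] by metis
    have mono: "is_mono A (k \<cdot> l)" and kl: "k \<cdot> l \<in> Hom A L X"
      using mono_comp[OF _ _ L(3) k(2)] kernel_mono L k Comp_closed by blast+
    then have LB: "L \<in> C' \<inter> D" using D_mono f L by blast
    have "is_kernel ?B (k \<cdot> l) f"
    proof (rule B.kernelI)
      show h: "k \<cdot> l \<in> Hom ?B L X" "f \<in> Hom ?B X Y"
        using kl LB f by (simp_all add: Hom_full_subcategory)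
      show "is_mono ?B (k \<cdot> l)"
        by (rule mono_full_subcategory[OF mono]) (use HomD[OF kl] LB f in simp_all)
      show "f \<cdot>\<^bsub>?B\<^esub> (k \<cdot> l) = Zero ?B L Y"
        using Comp_assoc[OF L(3) k(2) f(1)] kernel_Zero[OF k f(1)] Zero_Comp[OF L(3)]
          Hom_objects[OF f(1)] by simp
      fix W u assume "u \<in> Hom ?B W X" "f \<cdot>\<^bsub>?B\<^esub> u = Zero ?B W Y"
      then have u: "u \<in> Hom A W X" "W \<in> C'" "W \<in> D" "f \<cdot> u = Zero A W Y"
        by (auto dest: Hom_full_subcategoryD)
      obtain v where v: "v \<in> Hom A W K" "k \<cdot> v = u"
        using kernel_lift[OF k f(1) u(1,4)] by blast
      have "g \<cdot> v = Zero A W Q"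
        using t'.hom_zero[OF u(2) L(2)] Comp_closed[OF v(1) L(4)] by blast
      then obtain w where w: "w \<in> Hom A W L" "l \<cdot> w = v"
        using kernel_lift[OF L(5,3,4) v(1)] by blast
      then have "(k \<cdot> l) \<cdot> w = u" using Comp_assoc[OF w(1) L(3) k(2)] v by simp
      with w u LB show "\<exists>h \<in> Hom ?B W L. k \<cdot> l \<cdot>\<^bsub>?B\<^esub> h = u"
        by (auto simp: Hom_full_subcategory)
    qed
    then show "\<exists>k. is_kernel ?B k f" by blast
    obtain c K where c: "is_cokernel A c f" "c \<in> Hom A Y K"
      using cokernel_exists[OF HomD(1)[OF f(1)]] HomD[OF f(1)]
      by (metis ArD is_cokernel_def)
    obtain N Q n d where Q: "N \<in> C" "Q \<in> D" "n \<in> Hom A N K" "d \<in> Hom A K Q"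
      "is_kernel A n d" "is_cokernel A d n"
      using t.torsion_sequenceE Hom_objects(2)[OF c(2)] by metis
    have epi: "is_epi A (d \<cdot> c)" and dc: "d \<cdot> c \<in> Hom A Y Q"
      using epi_comp[OF _ _ c(2) Q(4)] cokernel_epi Q c Comp_closed by blast+
    then have QB: "Q \<in> C' \<inter> D" using C'_epi f Q by blast
    have "is_cokernel ?B (d \<cdot> c) f"
    proof (rule B.cokernelI)
      show h: "d \<cdot> c \<in> Hom ?B Y Q" "f \<in> Hom ?B X Y"
        using dc QB f by (simp_all add: Hom_full_subcategory)
      show "is_epi ?B (d \<cdot> c)"
        by (rule epi_full_subcategory[OF epi]) (use HomD[OF dc] QB f in simp_all)
      show "(d \<cdot> c) \<cdot>\<^bsub>?B\<^esub> f = Zero ?B X Q"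
        using Comp_assoc[OF f(1) c(2) Q(4)] cokernel_Zero[OF c f(1)] Comp_Zero[OF Q(4)]
          Hom_objects[OF f(1)] by simp
      fix W u assume "u \<in> Hom ?B Y W" "u \<cdot>\<^bsub>?B\<^esub> f = Zero ?B X W"
      then have u: "u \<in> Hom A Y W" "W \<in> C'" "W \<in> D" "u \<cdot> f = Zero A X W"
        by (auto dest: Hom_full_subcategoryD)
      obtain v where v: "v \<in> Hom A K W" "v \<cdot> c = u"
        using cokernel_desc[OF c f(1) u(1,4)] by blast
      have "v \<cdot> n = Zero A N W"
        using t.hom_zero[OF Q(1) u(3)] Comp_closed[OF Q(3) v(1)] by blast
      then obtain w where w: "w \<in> Hom A Q W" "w \<cdot> d = v"
        using cokernel_desc[OF Q(6,4,3) v(1)] by blast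
      then have "w \<cdot> (d \<cdot> c) = u" using Comp_assoc[OF c(2) Q(4) w(1)] v by simp
      with w u QB show "\<exists>h \<in> Hom ?B Q W. h \<cdot>\<^bsub>?B\<^esub> (d \<cdot> c) = u"
        by (auto simp: Hom_full_subcategory)
    qed
    then show "\<exists>c. is_cokernel ?B c f" by blast
  qed
qed

text \<open>
  For \<open>M\<close> in \<open>C' \<inter> D\<close>, the \<open>(U, V)\<close>-torsion part is a subobject of \<open>M\<close>, hence in \<open>D\<close>, and the
  torsion-free part is a quotient of \<open>M\<close>, hence in \<open>C'\<close>; together with \<open>U \<subseteq> C'\<close> and \<open>V \<subseteq> D\<close> this
  keeps the torsion sequence of \<open>M\<close> inside the subcategory.
\<close>

lemma (in pre_abelian_category) torsion_pair_restrict: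
  assumes "torsion_pair A C D" "torsion_pair A C' D'" "torsion_pair A U V" "C \<subseteq> U" "U \<subseteq> C'"
  shows "torsion_pair (full_subcategory A (C' \<inter> D)) (U \<inter> D) (V \<inter> C')" (is "torsion_pair ?B _ _")
proof -
  interpret t: torsion_pair A C D by fact
  interpret t': torsion_pair A C' D' by fact
  interpret s: torsion_pair A U V by fact
  interpret B: pre_abelian_category ?B using assms pre_abelian_full_subcategory by blast
  \<comment> \<open>Taking orthogonals reverses \<open>C \<subseteq> U\<close>.\<close>
  have VD: "V \<subseteq> D"
    using right_perp_antimono[OF assms(4)] s.torsion_free_eq_right_perp t.torsion_free_eq_right_perp
    by blast
  show ?thesis
  proof
    show "U \<inter> D \<subseteq> Ob ?B" "V \<inter> C' \<subseteq> Ob ?B"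
      using s.torsion_objects s.torsion_free_objects assms VD by auto
    have iso: "is_iso A f" if "is_iso ?B f" for f
      using that unfolding is_iso_def Ar_full_subcategory
      by (auto dest!: Hom_full_subcategoryD(1))
    show "iso_closed ?B (U \<inter> D)" "iso_closed ?B (V \<inter> C')"
      using iso s.torsion_iso_closed s.torsion_free_iso_closed t.torsion_free_iso_closed
        t'.torsion_iso_closed by (auto simp: iso_closed_def)
    fix X Y assume "X \<in> U \<inter> D" "Y \<in> V \<inter> C'"
    then show "Hom ?B X Y = {Zero ?B X Y}"
      using s.hom_zero[of X Y] assms VD by (auto simp: Hom_full_subcategory)
  next
    fix M assume "M \<in> Ob ?B"
    then have M: "M \<in> Ob A" "M \<in> C'" "M \<in> D" by auto
    obtain X Z f g where e: "X \<in> U" "Z \<in> V" "f \<in> Hom A X M" "g \<in> Hom A M Z"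
      "is_kernel A f g" "is_cokernel A g f"
      using s.torsion_sequenceE[OF M(1)] by blast
    have "X \<in> D" using right_perp_mono kernel_mono e M t.torsion_free_eq_right_perp by metis
    moreover have "Z \<in> C'" using left_perp_epi cokernel_epi e M t'.torsion_eq_left_perp by metis
    moreover note f = HomD[OF e(3)] and g = HomD[OF e(4)]
    ultimately have "short_exact ?B f g \<and> Dom ?B f \<in> U \<inter> D \<and> Cod ?B f = M \<and> Cod ?B g \<in> V \<inter> C'"
      using e M assms VD unfolding short_exact_def
      by (auto intro!: kernel_full_subcategory cokernel_full_subcategory)
    then show "\<exists>f g. short_exact ?B f g \<and> Dom ?B f \<in> U \<inter> D \<and> Cod ?B f = M \<and> Cod ?B g \<in> V \<inter> C'"
      by blast
  qed
qed

section \<open>Images and pullbacks in abelian categories\<close>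

context pre_abelian_category
begin

lemma kernelE:
  assumes "f \<in> Hom A X Y"
  obtains K k where "k \<in> Hom A K X" "is_kernel A k f" "is_mono A k"
proof -
  obtain k where "is_kernel A k f" using kernel_exists HomD(1)[OF assms] by blast
  then have "k \<in> Hom A (Dom A k) X" using HomD[OF assms] by (auto simp: is_kernel_def Hom_def)
  with \<open>is_kernel A k f\<close> kernel_mono that show thesis by blast
qed

lemma cokernelE:
  assumes "f \<in> Hom A X Y"
  obtains Q c where "c \<in> Hom A Y Q" "is_cokernel A c f" "is_epi A c"
proof -
  obtain c where "is_cokernel A c f" using cokernel_exists HomD(1)[OF assms] by blast
  then have "c \<in> Hom A Y (Cod A c)" using HomD[OF assms] by (auto simp: is_cokernel_def Hom_def)
  with \<open>is_cokernel A c f\<close> cokernel_epi that show thesis by blast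
qed

end

context abelian_category
begin

text \<open>
  \<open>m\<close> is the kernel of some \<open>g\<close>; as \<open>g\<close> kills \<open>m\<close>, it factors through \<open>c\<close>, so whatever \<open>c\<close> kills is
  also killed by \<open>g\<close> and lifts along \<open>m\<close>.
\<close>

lemma mono_kernel_of_cokernel:
  assumes m: "is_mono A m" "m \<in> Hom A X Y" and c: "is_cokernel A c m" "c \<in> Hom A Y Q"
  shows "is_kernel A m c"
proof (rule kernelI[OF m(2) c(2) m(1) cokernel_Zero[OF c m(2)]])
  fix W u assume u: "u \<in> Hom A W Y" "c \<cdot> u = Zero A W Q"
  obtain g where g: "is_kernel A m g" using mono_is_kernel[OF m(1)] by blast
  obtain Z where gZ: "g \<in> Hom A Y Z" using g HomD[OF m(2)] by (auto simp: is_kernel_def Hom_def)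
  obtain h where h: "h \<in> Hom A Q Z" "h \<cdot> c = g"
    using cokernel_desc[OF c m(2) gZ kernel_Zero[OF g m(2) gZ]] by blast
  have "g \<cdot> u = Zero A W Z"
    using Comp_assoc[OF u(1) c(2) h(1)] u h Comp_Zero[OF h(1)] Hom_objects(1)[OF u(1)] by simp
  then show "\<exists>v \<in> Hom A W X. m \<cdot> v = u" using kernel_lift[OF g m(2) gZ u(1)] by blast
qed

lemma epi_cokernel_of_kernel:
  assumes e: "is_epi A e" "e \<in> Hom A X Y" and k: "is_kernel A k e" "k \<in> Hom A K X"
  shows "is_cokernel A e k"
proof (rule cokernelI[OF e(2) k(2) e(1) kernel_Zero[OF k e(2)]])
  fix W u assume u: "u \<in> Hom A X W" "u \<cdot> k = Zero A K W"
  obtain g where g: "is_cokernel A e g" using epi_is_cokernel[OF e(1)] by blast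
  obtain Z where gZ: "g \<in> Hom A Z X" using g HomD[OF e(2)] by (auto simp: is_cokernel_def Hom_def)
  obtain h where h: "h \<in> Hom A Z K" "k \<cdot> h = g"
    using kernel_lift[OF k e(2) gZ cokernel_Zero[OF g e(2) gZ]] by blast
  have "u \<cdot> g = Zero A Z W"
    using Comp_assoc[OF h(1) k(2) u(1)] u h Zero_Comp[OF h(1)] Hom_objects(2)[OF u(1)] by simp
  then show "\<exists>v \<in> Hom A Y W. v \<cdot> e = u" using cokernel_desc[OF g e(2) gZ u(1)] by blast
qed

lemma mono_epi_iso:
  assumes "is_mono A m" "is_epi A m"
  shows "is_iso A m"
proof -
  have m: "m \<in> Hom A (Dom A m) (Cod A m)" using assms by (simp add: is_mono_def ArD)
  obtain g where g: "is_kernel A m g" using mono_is_kernel[OF assms(1)] by blast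
  obtain Z where gZ: "g \<in> Hom A (Cod A m) Z" using g HomD[OF m] by (auto simp: is_kernel_def Hom_def)
  have "g = Zero A (Cod A m) Z" using epi_Zero_cancel[OF assms(2) m gZ kernel_Zero[OF g m gZ]] .
  then show ?thesis using kernel_of_Zero_iso[OF _ m] g Hom_objects(2)[OF gZ] by blast
qed

text \<open>
  The image is the kernel of the cokernel. The first factor \<open>q\<close> is epi because the image is the
  smallest subobject through which \<open>f\<close> factors: if \<open>w\<close> kills \<open>q\<close>, then \<open>f\<close> factors through the
  kernel of \<open>w\<close>, which must therefore be all of the image.
\<close>

lemma epi_mono_factorization:
  assumes f: "f \<in> Hom A X Y"
  obtains I q m where "q \<in> Hom A X I" "m \<in> Hom A I Y" "is_epi A q" "is_mono A m" "m \<cdot> q = f"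
proof -
  obtain Q c where c: "c \<in> Hom A Y Q" "is_cokernel A c f" using cokernelE[OF f] by blast
  obtain I m where m: "m \<in> Hom A I Y" "is_kernel A m c" "is_mono A m" using kernelE[OF c(1)] by blast
  obtain q where q: "q \<in> Hom A X I" "m \<cdot> q = f"
    using kernel_lift[OF m(2,1) c(1) f cokernel_Zero[OF c(2,1) f]] by blast
  have "is_epi A q"
  proof (rule epi_ZeroI[OF q(1)])
    fix W w assume w: "w \<in> Hom A I W" "w \<cdot> q = Zero A X W"
    obtain K k where k: "k \<in> Hom A K I" "is_kernel A k w" "is_mono A k" using kernelE[OF w(1)] by blast
    obtain q' where q': "q' \<in> Hom A X K" "k \<cdot> q' = q" using kernel_lift[OF k(2,1) w(1) q(1) w(2)] by blast
    have mk: "m \<cdot> k \<in> Hom A K Y" "is_mono A (m \<cdot> k)"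
      using Comp_closed[OF k(1) m(1)] mono_comp[OF k(3) m(3) k(1) m(1)] by auto
    obtain g where g: "is_kernel A (m \<cdot> k) g" using mono_is_kernel[OF mk(2)] by blast
    obtain Z where gZ: "g \<in> Hom A Y Z" using g HomD[OF mk(1)] by (auto simp: is_kernel_def Hom_def)
    \<comment> \<open>\<open>f\<close> factors through the subobject \<open>m \<cdot> k\<close>, so \<open>g\<close> kills \<open>f\<close> and hence the whole of \<open>I\<close>.\<close>
    have f': "f = (m \<cdot> k) \<cdot> q'" using Comp_assoc[OF q'(1) k(1) m(1)] q q' by simp
    have "g \<cdot> f = Zero A X Z"
      unfolding f' using Comp_assoc[OF q'(1) mk(1) gZ] kernel_Zero[OF g mk(1) gZ]
        Zero_Comp[OF q'(1)] Hom_objects(2)[OF gZ] by simp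
    then obtain h where h: "h \<in> Hom A Q Z" "h \<cdot> c = g" using cokernel_desc[OF c(2,1) f gZ] by blast
    have "g \<cdot> m = Zero A I Z"
      using Comp_assoc[OF m(1) c(1) h(1)] h kernel_Zero[OF m(2,1) c(1)] Comp_Zero[OF h(1)]
        Hom_objects(1)[OF m(1)] by simp
    then obtain s where s: "s \<in> Hom A I K" "(m \<cdot> k) \<cdot> s = m" using kernel_lift[OF g mk(1) gZ m(1)] by blast
    have I: "I \<in> Ob A" using Hom_objects m by blast
    have "m \<cdot> (k \<cdot> s) = m \<cdot> Idt A I" using Comp_assoc[OF s(1) k(1) m(1)] s Comp_Idt[OF m(1)] by simp
    then have "k \<cdot> s = Idt A I"
      using monoD[OF m(3,1) Comp_closed[OF s(1) k(1)] Idt_closed[OF I]] by blast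
    then have "w = w \<cdot> (k \<cdot> s)" using Comp_Idt[OF w(1)] by simp
    also have "\<dots> = (w \<cdot> k) \<cdot> s" using Comp_assoc[OF s(1) k(1) w(1)] by simp
    also have "\<dots> = Zero A I W"
      using kernel_Zero[OF k(2,1) w(1)] Zero_Comp[OF s(1)] Hom_objects(2)[OF w(1)] by simp
    finally show "w = Zero A I W" .
  qed
  with q m that show thesis by blast
qed

text \<open>
  Pullbacks of epimorphisms are epi. The pullback of \<open>e\<close> and \<open>t\<close> is the kernel of their difference
  \<open>d = e - t\<close> on \<open>M \<oplus> L\<close>, and \<open>d\<close> is epi since \<open>e\<close> is, hence the cokernel of this kernel. If \<open>w\<close>
  kills \<open>r\<close>, then \<open>w\<close>, read as a map on \<open>M \<oplus> L\<close> that is zero on \<open>M\<close>, factors through \<open>d\<close> as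
  \<open>s \<cdot> d\<close>; restricting to \<open>M\<close> gives \<open>s \<cdot> e = 0\<close>, so \<open>s = 0\<close> and \<open>w = 0\<close>.
\<close>

lemma epi_pullback:
  assumes e: "is_epi A e" "e \<in> Hom A M N" and t: "t \<in> Hom A L N"
    and r: "r \<in> Hom A X L"
    and weak_pullback: "\<And>V a b. \<lbrakk>a \<in> Hom A V M; b \<in> Hom A V L; e \<cdot> a = t \<cdot> b\<rbrakk>
      \<Longrightarrow> \<exists>v \<in> Hom A V X. r \<cdot> v = b"
  shows "is_epi A r"
proof (rule epi_ZeroI[OF r])
  fix W w assume w: "w \<in> Hom A L W" "w \<cdot> r = Zero A X W"
  have ob: "M \<in> Ob A" "N \<in> Ob A" "L \<in> Ob A" "W \<in> Ob A"
    using Hom_objects e(2) t w(1) by blast+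
  obtain P i j p q where "is_biproduct A M L P i j p q" using biproduct_exists[OF ob(1,3)] by blast
  then have P: "P \<in> Ob A" "i \<in> Hom A M P" "j \<in> Hom A L P" "p \<in> Hom A P M" "q \<in> Hom A P L"
    "p \<cdot> i = Idt A M" "q \<cdot> j = Idt A L" "q \<cdot> i = Zero A M L"
    by (auto simp: is_biproduct_def)
  note ep = Comp_closed[OF P(4) e(2)] and tq = Comp_closed[OF P(5) t]
  \<comment> \<open>\<open>d\<close> is the difference \<open>e \<cdot> p - t \<cdot> q\<close>, whose kernel is the pullback of \<open>e\<close> and \<open>t\<close>.\<close>
  obtain d where d: "d \<in> Hom A P N" "d \<oplus> t \<cdot> q = e \<cdot> p" using difference_exists[OF ep tq] by blast
  have di: "d \<cdot> i = e"
  proof -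
    have "d \<cdot> i \<oplus> (t \<cdot> q) \<cdot> i = (e \<cdot> p) \<cdot> i" using Comp_Add[OF P(2) d(1) tq] d(2) by simp
    moreover have "(t \<cdot> q) \<cdot> i = Zero A M N" using Comp_assoc[OF P(2,5) t] P(8) Comp_Zero[OF t ob(1)] by simp
    moreover have "(e \<cdot> p) \<cdot> i = e" using Comp_assoc[OF P(2,4) e(2)] P(6) Comp_Idt[OF e(2)] by simp
    ultimately show ?thesis using Add_Zero(1)[OF Comp_closed[OF P(2) d(1)]] by simp
  qed
  then have "is_epi A d" using epi_cancel[OF _ P(2) d(1)] e(1) by simp
  obtain K k where k: "k \<in> Hom A K P" "is_kernel A k d" using kernelE[OF d(1)] by blast
  have dk: "is_cokernel A d k" using epi_cokernel_of_kernel[OF \<open>is_epi A d\<close> d(1) k(2,1)] .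
  note pk = Comp_closed[OF k(1) P(4)] and qk = Comp_closed[OF k(1) P(5)]
  have "d \<cdot> k \<oplus> (t \<cdot> q) \<cdot> k = (e \<cdot> p) \<cdot> k" using Comp_Add[OF k(1) d(1) tq] d(2) by simp
  then have "e \<cdot> (p \<cdot> k) = t \<cdot> (q \<cdot> k)"
    using kernel_Zero[OF k(2,1) d(1)] Add_Zero(2)[OF Comp_closed[OF k(1) tq]]
      Comp_assoc[OF k(1) P(4) e(2)] Comp_assoc[OF k(1) P(5) t] by simp
  then obtain v where v: "v \<in> Hom A K X" "r \<cdot> v = q \<cdot> k" using weak_pullback[OF pk qk] by blast
  note wq = Comp_closed[OF P(5) w(1)]
  have "(w \<cdot> q) \<cdot> k = (w \<cdot> r) \<cdot> v"
    using Comp_assoc[OF k(1) P(5) w(1)] Comp_assoc[OF v(1) r w(1)] v(2) by simp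
  also have "\<dots> = Zero A K W" using w(2) Zero_Comp[OF v(1) ob(4)] by simp
  finally obtain s where s: "s \<in> Hom A N W" "s \<cdot> d = w \<cdot> q"
    using cokernel_desc[OF dk d(1) k(1) wq] by blast
  have "s \<cdot> e = (w \<cdot> q) \<cdot> i" using Comp_assoc[OF P(2) d(1) s(1)] di s(2) by simp
  also have "\<dots> = Zero A M W" using Comp_assoc[OF P(2,5) w(1)] P(8) Comp_Zero[OF w(1) ob(1)] by simp
  finally have "s = Zero A N W" using epi_Zero_cancel[OF e s(1)] by blast
  then have "w \<cdot> q = Zero A P W" using s(2) Zero_Comp[OF d(1) ob(4)] by simp
  then have "w \<cdot> (q \<cdot> j) = Zero A L W" using Comp_assoc[OF P(3,5) w(1)] Zero_Comp[OF P(3) ob(4)] by simp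
  then show "w = Zero A L W" using P(7) Comp_Idt[OF w(1)] by simp
qed

text \<open>
  For the quotient \<open>N\<close> of \<open>M\<close> by \<open>I\<close> and a subobject \<open>L\<close> of \<open>N\<close>, the preimage \<open>X\<close> of \<open>L\<close> in \<open>M\<close> is
  an extension of \<open>L\<close> by \<open>I\<close>. Exactness at \<open>L\<close>, that is, that \<open>X \<rightarrow> L\<close> is epi, comes from
  \<open>epi_pullback\<close>. The subobject \<open>L\<close> is given as the kernel of \<open>g\<close>, so that \<open>X\<close> is the kernel of \<open>g \<cdot> e\<close>.
\<close>

lemma left_perp_preimage:
  assumes i: "is_kernel A i e" "i \<in> Hom A I M" "I \<in> left_perp A F"
    and e: "is_epi A e" "e \<in> Hom A M N"
    and t: "is_kernel A t g" "t \<in> Hom A L N" "L \<in> left_perp A F"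
    and g: "g \<in> Hom A N Z"
    and x: "is_kernel A x (g \<cdot> e)" "x \<in> Hom A X M"
  shows "X \<in> left_perp A F"
proof -
  note ge = Comp_closed[OF e(2) g] and ex = Comp_closed[OF x(2) e(2)]
  have Z: "Z \<in> Ob A" using Hom_objects g by blast
  have "g \<cdot> (e \<cdot> x) = Zero A X Z" using kernel_Zero[OF x ge] Comp_assoc[OF x(2) e(2) g] by simp
  then obtain r where r: "r \<in> Hom A X L" "t \<cdot> r = e \<cdot> x" using kernel_lift[OF t(1,2) g ex] by blast
  have "(g \<cdot> e) \<cdot> i = Zero A I Z"
    using Comp_assoc[OF i(2) e(2) g] kernel_Zero[OF i(1,2) e(2)] Comp_Zero[OF g] Hom_objects(1)[OF i(2)]
    by simp
  then obtain i' where i': "i' \<in> Hom A I X" "x \<cdot> i' = i" using kernel_lift[OF x ge i(2)] by blast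
  have "is_epi A r"
  proof (rule epi_pullback[OF e t(2) r(1)])
    fix V a b assume ab: "a \<in> Hom A V M" "b \<in> Hom A V L" "e \<cdot> a = t \<cdot> b"
    have "(g \<cdot> e) \<cdot> a = (g \<cdot> t) \<cdot> b"
      using Comp_assoc[OF ab(1) e(2) g] Comp_assoc[OF ab(2) t(2) g] ab(3) by simp
    also have "\<dots> = Zero A V Z" using kernel_Zero[OF t(1,2) g] Zero_Comp[OF ab(2) Z] by simp
    finally obtain v where v: "v \<in> Hom A V X" "x \<cdot> v = a" using kernel_lift[OF x ge ab(1)] by blast
    have "t \<cdot> (r \<cdot> v) = t \<cdot> b"
      using Comp_assoc[OF v(1) r(1) t(2)] Comp_assoc[OF v(1) x(2) e(2)] r(2) v(2) ab(3) by simp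
    then show "\<exists>v \<in> Hom A V X. r \<cdot> v = b"
      using monoD[OF kernel_mono[OF t(1)] t(2) Comp_closed[OF v(1) r(1)] ab(2)] v(1) by blast
  qed
  moreover have "is_kernel A i' r"
  proof (rule kernelI[OF i'(1) r(1)])
    show "is_mono A i'"
    proof (rule monoI[OF i'(1)])
      fix W u v assume uv: "u \<in> Hom A W I" "v \<in> Hom A W I" "i' \<cdot> u = i' \<cdot> v"
      have "i \<cdot> u = i \<cdot> v" using Comp_assoc[OF uv(1) i'(1) x(2)] Comp_assoc[OF uv(2) i'(1) x(2)] uv(3) i'(2)
        by simp
      then show "u = v" using monoD[OF kernel_mono[OF i(1)] i(2) uv(1,2)] by blast
    qed
    note ri' = Comp_closed[OF i'(1) r(1)]
    have "t \<cdot> (r \<cdot> i') = Zero A I N"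
      using Comp_assoc[OF i'(1) r(1) t(2)] Comp_assoc[OF i'(1) x(2) e(2)] r(2) i'(2)
        kernel_Zero[OF i(1,2) e(2)] by simp
    then show "r \<cdot> i' = Zero A I L" using mono_Zero_cancel[OF kernel_mono[OF t(1)] t(2) ri'] by blast
    fix W u assume u: "u \<in> Hom A W X" "r \<cdot> u = Zero A W L"
    note xu = Comp_closed[OF u(1) x(2)]
    have "e \<cdot> (x \<cdot> u) = Zero A W N"
      using Comp_assoc[OF u(1) x(2) e(2)] Comp_assoc[OF u(1) r(1) t(2)] r(2) u(2)
        Comp_Zero[OF t(2)] Hom_objects(1)[OF u(1)] by simp
    then obtain v where v: "v \<in> Hom A W I" "i \<cdot> v = x \<cdot> u" using kernel_lift[OF i(1,2) e(2) xu] by blast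
    have "x \<cdot> (i' \<cdot> v) = x \<cdot> u" using Comp_assoc[OF v(1) i'(1) x(2)] i'(2) v(2) by simp
    then show "\<exists>h \<in> Hom A W I. i' \<cdot> h = u"
      using monoD[OF kernel_mono[OF x(1)] x(2) Comp_closed[OF v(1) i'(1)] u(1)] v(1) by blast
  qed
  ultimately have "is_cokernel A r i'" using epi_cokernel_of_kernel[OF _ r(1) _ i'(1)] by blast
  then show ?thesis using left_perp_extension[OF i(3) t(3) _ i'(1) r(1)] by blast
qed

end

section \<open>Finite length and the ascending chain condition\<close>

text \<open>
  Subobjects of \<open>M\<close> correspond to quotients of \<open>M\<close>, larger subobjects having smaller quotients. The
  ascending chain condition on subobjects thus says that passing from an object to a proper
  quotient is well-founded below \<open>M\<close>. Defining it as accessibility provides the induction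
  principle directly and avoids the choice of chains.
\<close>

inductive noetherian :: "('o, 'm) preadditive_data \<Rightarrow> 'o \<Rightarrow> bool"
  for A where
  noetherianI: "(\<And>e. \<lbrakk>is_epi A e; Dom A e = M; \<not> is_iso A e\<rbrakk> \<Longrightarrow> noetherian A (Cod A e)) \<Longrightarrow> noetherian A M"

context abelian_category
begin

lemma simple_epi:
  assumes S: "is_simple A S" and e: "is_epi A e" "e \<in> Hom A S Y"
  shows "is_zero_object A Y \<or> is_iso A e"
proof -
  obtain K k where k: "k \<in> Hom A K S" "is_kernel A k e" "is_mono A k" using kernelE[OF e(2)] by blast
  have Y: "Y \<in> Ob A" using Hom_objects e by blast
  consider "is_zero_object A K" | "is_iso A k"
    using S k(3) HomD[OF k(1)] unfolding is_simple_def by blast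
  then show ?thesis
  proof cases
    case 1
    have "is_mono A e"
    proof (rule mono_ZeroI[OF e(2)])
      fix W u assume u: "u \<in> Hom A W S" "e \<cdot> u = Zero A W Y"
      then obtain h where h: "h \<in> Hom A W K" "k \<cdot> h = u" using kernel_lift[OF k(2,1) e(2)] by blast
      then have "h = Zero A W K" using zero_object_Hom 1 by blast
      then show "u = Zero A W S" using h Comp_Zero[OF k(1)] Hom_objects(1)[OF u(1)] by simp
    qed
    then show ?thesis using mono_epi_iso e by blast
  next
    case 2
    have "e = Zero A S Y"
      using epi_Zero_cancel[OF iso_epi[OF 2] k(1) e(2) kernel_Zero[OF k(2,1) e(2)]] .
    then have "Idt A Y \<cdot> e = Zero A S Y" using Idt_Comp[OF e(2)] by simp
    then have "Idt A Y = Zero A Y Y" using epi_Zero_cancel[OF e Idt_closed[OF Y]] by blast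
    then show ?thesis using Y zero_object_iff by blast
  qed
qed

lemma noetherian_epi:
  assumes M: "noetherian A M" and e: "is_epi A e" "e \<in> Hom A M N"
  shows "noetherian A N"
proof (cases "is_iso A e")
  case False
  then show ?thesis using M e HomD[OF e(2)] by (metis noetherian.cases)
next
  case True
  then obtain e' where e': "e' \<in> Hom A N M" "e \<cdot> e' = Idt A N" using isoE e by metis
  show ?thesis
  proof (rule noetherianI)
    fix d assume d: "is_epi A d" "Dom A d = N" "\<not> is_iso A d"
    then have dh: "d \<in> Hom A N (Cod A d)" using ArD unfolding is_epi_def by metis
    note de = Comp_closed[OF e(2) dh]
    have "\<not> is_iso A (d \<cdot> e)"
    proof
      assume iso: "is_iso A (d \<cdot> e)"
      have "is_mono A d"
      proof (rule mono_ZeroI[OF dh])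
        fix W u assume u: "u \<in> Hom A W N" "d \<cdot> u = Zero A W (Cod A d)"
        note e'u = Comp_closed[OF u(1) e'(1)]
        have u': "e \<cdot> (e' \<cdot> u) = u" using Comp_assoc[OF u(1) e'(1) e(2)] e'(2) Idt_Comp[OF u(1)] by simp
        then have "(d \<cdot> e) \<cdot> (e' \<cdot> u) = Zero A W (Cod A d)" using Comp_assoc[OF e'u e(2) dh] u(2) by simp
        then have "e' \<cdot> u = Zero A W M" using mono_Zero_cancel[OF iso_mono[OF iso] de e'u] by blast
        then show "u = Zero A W N" using u' Comp_Zero[OF e(2)] Hom_objects(1)[OF u(1)] by simp
      qed
      then show False using mono_epi_iso d by blast
    qed
    moreover have "is_epi A (d \<cdot> e)" using epi_comp[OF e(1) d(1) e(2) dh] .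
    ultimately show "noetherian A (Cod A d)" using M HomD[OF de] by (metis noetherian.cases)
  qed
qed

text \<open>
  By induction on the subobject \<open>X\<close>. A proper quotient \<open>e: Y \<rightarrow> Y'\<close> restricts to a quotient
  \<open>q: X \<rightarrow> X'\<close> onto the image of \<open>X\<close> and induces a quotient \<open>s: S \<rightarrow> S'\<close> onto the cokernel of
  \<open>X' \<rightarrow> Y'\<close>. As \<open>S\<close> is simple, either \<open>S'\<close> is zero, and then \<open>Y'\<close> is isomorphic to the quotient
  \<open>X'\<close> of \<open>X\<close>, or \<open>s\<close> is an isomorphism. In the latter case \<open>q\<close> is not an isomorphism, as otherwise
  \<open>e\<close> would be one by the five lemma, and the induction hypothesis applies to \<open>X'\<close>.
\<close>

lemma noetherian_extension:
  assumes "noetherian A X" "x \<in> Hom A X Y" "c \<in> Hom A Y S" "is_kernel A x c" "is_epi A c" "is_simple A S"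
  shows "noetherian A Y"
  using assms
proof (induction X arbitrary: Y x c rule: noetherian.induct)
  case (noetherianI X)
  note x = noetherianI.prems(1) and c = noetherianI.prems(2) and xc = noetherianI.prems(3)
    and c_epi = noetherianI.prems(4) and S = noetherianI.prems(5)
  have X: "noetherian A X" using noetherianI.hyps by (rule noetherian.noetherianI)
  show ?case
  proof (rule noetherian.noetherianI)
    fix e assume e: "is_epi A e" "Dom A e = Y" "\<not> is_iso A e"
    obtain Y' where Y': "Cod A e = Y'" "e \<in> Hom A Y Y'" using e ArD unfolding is_epi_def by metis
    note ex = Comp_closed[OF x Y'(2)]
    obtain X' q m where qm: "q \<in> Hom A X X'" "m \<in> Hom A X' Y'" "is_epi A q" "is_mono A m" "m \<cdot> q = e \<cdot> x"
      using epi_mono_factorization[OF ex] by blast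
    obtain S' c' where c': "c' \<in> Hom A Y' S'" "is_cokernel A c' m" "is_epi A c'"
      using cokernelE[OF qm(2)] by blast
    have mc': "is_kernel A m c'" using mono_kernel_of_cokernel[OF qm(4,2) c'(2,1)] .
    have S'ob: "S' \<in> Ob A" using Hom_objects c' by blast
    note c'e = Comp_closed[OF Y'(2) c'(1)]
    have "(c' \<cdot> e) \<cdot> x = (c' \<cdot> m) \<cdot> q"
      using Comp_assoc[OF x Y'(2) c'(1)] Comp_assoc[OF qm(1,2) c'(1)] qm(5) by simp
    also have "\<dots> = Zero A X S'" using cokernel_Zero[OF c'(2,1) qm(2)] Zero_Comp[OF qm(1) S'ob] by simp
    finally obtain s where s: "s \<in> Hom A S S'" "s \<cdot> c = c' \<cdot> e"
      using cokernel_desc[OF epi_cokernel_of_kernel[OF c_epi c xc x] c x c'e] by blast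
    have "is_epi A s" using epi_cancel[OF _ c s(1)] s(2) epi_comp[OF e(1) c'(3) Y'(2) c'(1)] by simp
    then consider "is_zero_object A S'" | "is_iso A s" using simple_epi[OF S _ s(1)] by blast
    then show "noetherian A (Cod A e)"
    proof cases
      case 1
      have "is_epi A m"
      proof (rule epi_ZeroI[OF qm(2)])
        fix W u assume u: "u \<in> Hom A Y' W" "u \<cdot> m = Zero A X' W"
        obtain h where "h \<in> Hom A S' W" "h \<cdot> c' = u" using cokernel_desc[OF c'(2,1) qm(2) u] by blast
        then show "u = Zero A Y' W"
          using zero_object_Hom(2)[OF 1] Zero_Comp[OF c'(1)] Hom_objects(2)[OF u(1)] by metis
      qed
      then show ?thesis using noetherian_epi[OF noetherian_epi[OF X qm(3,1)] _ qm(2)] Y'(1) by simp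
    next
      case 2
      \<comment> \<open>The five lemma: an arrow killed by \<open>e\<close> is killed by \<open>c\<close>, so it factors through \<open>x\<close>, and \<open>e \<cdot> x\<close> is mono.\<close>
      have "\<not> is_iso A q"
      proof
        assume "is_iso A q"
        then have ex_mono: "is_mono A (e \<cdot> x)" using mono_comp[OF iso_mono qm(4,1,2)] qm(5) by simp
        have "is_mono A e"
        proof (rule mono_ZeroI[OF Y'(2)])
          fix W u assume u: "u \<in> Hom A W Y" "e \<cdot> u = Zero A W Y'"
          note cu = Comp_closed[OF u(1) c]
          have "s \<cdot> (c \<cdot> u) = Zero A W S'"
            using Comp_assoc[OF u(1) c s(1)] Comp_assoc[OF u(1) Y'(2) c'(1)] s(2) u(2)
              Comp_Zero[OF c'(1)] Hom_objects(1)[OF u(1)] by simp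
          then have "c \<cdot> u = Zero A W S" using mono_Zero_cancel[OF iso_mono[OF 2] s(1) cu] by blast
          then obtain v where v: "v \<in> Hom A W X" "x \<cdot> v = u" using kernel_lift[OF xc x c u(1)] by blast
          then have "(e \<cdot> x) \<cdot> v = Zero A W Y'" using Comp_assoc[OF v(1) x Y'(2)] u(2) by simp
          then have "v = Zero A W X" using mono_Zero_cancel[OF ex_mono ex v(1)] by blast
          then show "u = Zero A W Y" using v Comp_Zero[OF x] Hom_objects(1)[OF u(1)] by simp
        qed
        then show False using mono_epi_iso e by blast
      qed
      \<comment> \<open>Identifying \<open>S'\<close> with \<open>S\<close> spares a proof that simplicity is invariant under isomorphism.\<close>
      obtain s' where s': "s' \<in> Hom A S' S" "is_iso A s'" using isoE[OF 2 s(1)] by blast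
      note s'c' = Comp_closed[OF c'(1) s'(1)]
      have "is_kernel A m (s' \<cdot> c')"
      proof (rule kernelI[OF qm(2) s'c' qm(4)])
        show "s' \<cdot> c' \<cdot> m = Zero A X' S"
          using Comp_assoc[OF qm(2) c'(1) s'(1)] cokernel_Zero[OF c'(2,1) qm(2)] Comp_Zero[OF s'(1)]
            Hom_objects(1)[OF qm(2)] by simp
        fix W u assume u: "u \<in> Hom A W Y'" "s' \<cdot> c' \<cdot> u = Zero A W S"
        then have "s' \<cdot> (c' \<cdot> u) = Zero A W S" using Comp_assoc[OF u(1) c'(1) s'(1)] by simp
        then have "c' \<cdot> u = Zero A W S'"
          using mono_Zero_cancel[OF iso_mono[OF s'(2)] s'(1) Comp_closed[OF u(1) c'(1)]] by blast
        then show "\<exists>h \<in> Hom A W X'. m \<cdot> h = u" using kernel_lift[OF mc' qm(2) c'(1) u(1)] by blast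
      qed
      moreover have "is_epi A (s' \<cdot> c')" using epi_comp[OF c'(3) iso_epi[OF s'(2)] c'(1) s'(1)] .
      ultimately show ?thesis
        using noetherianI.IH[OF qm(3) HomD(2)[OF qm(1)] \<open>\<not> is_iso A q\<close>, of m Y' "s' \<cdot> c'"]
          HomD(3)[OF qm(1)] qm(2) s'c' S Y'(1) by simp
    qed
  qed
qed

lemma noetherian_zero_object:
  assumes "is_zero_object A Z"
  shows "noetherian A Z"
proof (rule noetherianI)
  fix e assume e: "is_epi A e" "Dom A e = Z" "\<not> is_iso A e"
  then have "e \<in> Hom A Z (Cod A e)" using ArD unfolding is_epi_def by metis
  then have "is_mono A e" using mono_from_zero_object assms by blast
  then show "noetherian A (Cod A e)" using mono_epi_iso e by blast
qed

lemma finite_length_noetherian: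
  assumes "has_finite_length A M"
  shows "noetherian A M"
proof -
  obtain n :: nat and X i where X: "is_zero_object A (X 0)" "X n = M"
    and i: "\<And>k. k < n \<Longrightarrow> i k \<in> Hom A (X k) (X (Suc k)) \<and> is_mono A (i k) \<and>
      (\<exists>c. is_cokernel A c (i k) \<and> is_simple A (Cod A c))"
    using assms unfolding has_finite_length_def by blast
  have "noetherian A (X k)" if "k \<le> n" for k
    using that
  proof (induction k)
    case 0
    then show ?case using noetherian_zero_object X by simp
  next
    case (Suc k)
    then obtain c where ik: "i k \<in> Hom A (X k) (X (Suc k))" "is_mono A (i k)"
      and c: "is_cokernel A c (i k)" "is_simple A (Cod A c)" using i[of k] by auto
    have ch: "c \<in> Hom A (X (Suc k)) (Cod A c)" using c HomD[OF ik(1)] by (auto simp: is_cokernel_def Hom_def)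
    show ?case
      using noetherian_extension[OF _ ik(1) ch mono_kernel_of_cokernel[OF ik(2,1) c(1) ch]
          cokernel_epi[OF c(1)] c(2)] Suc by simp
  qed
  with X show ?thesis by blast
qed

end

section \<open>Torsion classes of a length category\<close>

text \<open>
  By induction along proper quotients. If \<open>M\<close> receives a nonzero map from \<open>T\<close>, its image \<open>I\<close> is a
  nonzero subobject in \<open>T\<close>. A torsion sequence of \<open>M/I\<close> pulls back to one of \<open>M\<close>: the torsion-free
  part is unchanged, and the torsion part becomes an extension by \<open>I\<close>, which is in \<open>T\<close> again by
  \<open>left_perp_preimage\<close>.
\<close>

lemma (in abelian_category) noetherian_torsion_sequence:
  assumes "noetherian A M" "M \<in> Ob A" and T: "T = left_perp A F'"
  shows "\<exists>X Z f g. X \<in> T \<and> Z \<in> right_perp A T \<and> f \<in> Hom A X M \<and> g \<in> Hom A M Z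
    \<and> is_kernel A f g \<and> is_cokernel A g f"
  using assms(1,2)
proof (induction M rule: noetherian.induct)
  case (noetherianI M)
  show ?case
  proof (cases "M \<in> right_perp A T")
    case True
    obtain O' where O': "is_zero_object A O'" using zero_object_exists by blast
    then have O'ob: "O' \<in> Ob A" using zero_object_iff by blast
    note M = \<open>M \<in> Ob A\<close>
    note z = Zero_Hom[OF O'ob M] and I = Idt_closed[OF M]
    have "is_kernel A (Zero A O' M) (Idt A M)"
    proof (rule kernelI[OF z I mono_from_zero_object[OF z O'] Idt_Comp[OF z]])
      fix W u assume u: "u \<in> Hom A W M" "Idt A M \<cdot> u = Zero A W M"
      then have "Zero A O' M \<cdot> Zero A W O' = u"
        using Idt_Comp Comp_Zero[OF z] Hom_objects by metis
      then show "\<exists>h \<in> Hom A W O'. Zero A O' M \<cdot> h = u" using Zero_Hom O'ob Hom_objects(1)[OF u(1)] by blast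
    qed
    moreover have "is_cokernel A (Idt A M) (Zero A O' M)"
    proof (rule cokernelI[OF I z _ Idt_Comp[OF z]])
      show "is_epi A (Idt A M)" using iso_epi isoI[OF I I] Idt_Comp[OF I] by blast
    qed (use Comp_Idt in blast)
    moreover have "O' \<in> T" using left_perp_zero_object[OF O'] T by blast
    ultimately show ?thesis using True z I by blast
  next
    case False
    then obtain Y h where Y: "Y \<in> T" "h \<in> Hom A Y M" "h \<noteq> Zero A Y M"
      using right_perpI[of M A T] \<open>M \<in> Ob A\<close> by blast
    obtain I q m where I: "q \<in> Hom A Y I" "m \<in> Hom A I M" "is_epi A q" "is_mono A m" "m \<cdot> q = h"
      using epi_mono_factorization[OF Y(2)] by blast
    have IT: "I \<in> left_perp A F'" using left_perp_epi[OF _ I(3,1)] Y(1) T by blast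
    obtain N c where c: "c \<in> Hom A M N" "is_cokernel A c m" "is_epi A c" using cokernelE[OF I(2)] by blast
    have "\<not> is_iso A c"
    proof
      assume "is_iso A c"
      then have "m = Zero A I M"
        using mono_Zero_cancel[OF iso_mono c(1) I(2) cokernel_Zero[OF c(2,1) I(2)]] by blast
      then show False using Y(3) I(5) Zero_Comp[OF I(1)] Hom_objects(2)[OF I(2)] by simp
    qed
    then obtain L Z t g where L: "L \<in> T" "Z \<in> right_perp A T" "t \<in> Hom A L N" "g \<in> Hom A N Z"
      "is_kernel A t g" "is_cokernel A g t"
      using noetherianI.IH[OF c(3) HomD(2)[OF c(1)]] HomD(3)[OF c(1)] Hom_objects(2)[OF c(1)] by blast
    note gc = Comp_closed[OF c(1) L(4)]
    have gc_epi: "is_epi A (g \<cdot> c)" using epi_comp[OF c(3) cokernel_epi[OF L(6)] c(1) L(4)] .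
    obtain X x where x: "x \<in> Hom A X M" "is_kernel A x (g \<cdot> c)" using kernelE[OF gc] by blast
    have "X \<in> T"
      using left_perp_preimage[OF mono_kernel_of_cokernel[OF I(4,2) c(2,1)] I(2) IT c(3,1) L(5,3) _ L(4) x(2,1)]
        L(1) T by blast
    moreover have "is_cokernel A (g \<cdot> c) x" using epi_cokernel_of_kernel[OF gc_epi gc x(2,1)] .
    ultimately show ?thesis using x gc L(2) by blast
  qed
qed

lemma (in abelian_length_category) left_perp_torsion_pair:
  "torsion_pair A (left_perp A F) (right_perp A (left_perp A F))"
proof (rule torsion_pairI[OF refl refl])
  fix M assume "M \<in> Ob A"
  then show "\<exists>X Z f g. X \<in> left_perp A F \<and> Z \<in> right_perp A (left_perp A F) \<and> f \<in> Hom A X M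
    \<and> g \<in> Hom A M Z \<and> is_kernel A f g \<and> is_cokernel A g f"
    using noetherian_torsion_sequence[OF finite_length_noetherian[OF finite_length] _ refl] by blast
qed

section \<open>Lattices of torsion classes\<close>

lemma partial_order_torsion_classes: "partial_order (torsion_classes A)"
  by standard (auto simp: torsion_classes_def)

text \<open>
  The top element is the left orthogonal of the empty class, and the intersection of the classes
  \<open>T = left_perp A (right_perp A T)\<close> is the left orthogonal of the union of the \<open>right_perp A T\<close>.
  The hypothesis is kept abstract because the lemma is applied both to a length category and to a
  pre-abelian subcategory of it.
\<close>

lemma (in pre_abelian_category) complete_lattice_torsion_classes:
  assumes left_perp_torsion: "\<And>F. F \<subseteq> Ob A \<Longrightarrow> torsion_class A (left_perp A F)"
  shows "complete_lattice (torsion_classes A)" (is "complete_lattice ?L")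
proof (rule partial_order.complete_lattice_criterion1[OF partial_order_torsion_classes])
  have objects: "T \<subseteq> Ob A" if "torsion_class A T" for T
    using that torsion_pair.torsion_objects unfolding torsion_class_def by blast
  have "torsion_class A (Ob A)" using left_perp_torsion[of "{}"] by (simp add: left_perp_def)
  then have "greatest ?L (Ob A) (carrier ?L)"
    using objects by (auto simp: greatest_def torsion_classes_def)
  then show "\<exists>g. greatest ?L g (carrier ?L)" by blast
next
  fix K assume "K \<subseteq> carrier ?L" and ne: "K \<noteq> {}"
  then have K: "\<And>T. T \<in> K \<Longrightarrow> torsion_class A T" by (auto simp: torsion_classes_def)
  have perp: "T = left_perp A (right_perp A T)" if "torsion_class A T" for T
    using that torsion_pair.torsion_eq_left_perp torsion_pair.torsion_free_eq_right_perp
    unfolding torsion_class_def by metis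
  have "\<Inter>K = (\<Inter>T\<in>K. left_perp A (right_perp A T))" using perp K by auto
  also have "\<dots> = left_perp A (\<Union>T\<in>K. right_perp A T)" using ne by (auto simp: left_perp_def)
  finally have "\<Inter>K = left_perp A (\<Union>T\<in>K. right_perp A T)" .
  moreover have "(\<Union>T\<in>K. right_perp A T) \<subseteq> Ob A" by (auto simp: right_perp_def)
  ultimately have "torsion_class A (\<Inter>K)" using left_perp_torsion by simp
  then have "greatest ?L (\<Inter>K) (Lower ?L K)"
    using K by (auto simp: greatest_def Lower_def torsion_classes_def)
  then show "\<exists>i. greatest ?L i (Lower ?L K)" by blast
qed

text \<open>
  Split \<open>M\<close> in \<open>U\<close> by the torsion pair \<open>(C, D)\<close>: the sub lies in \<open>C\<close>, the quotient in \<open>U \<inter> D\<close>, and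
  \<open>U'\<close> contains both and is closed under extensions.
\<close>

lemma (in pre_abelian_category) torsion_class_le_if_inter_le:
  assumes "torsion_pair A C D" "torsion_class A U" "torsion_class A U'"
    and "C \<subseteq> U'" "U \<inter> D \<subseteq> U'"
  shows "U \<subseteq> U'"
proof
  obtain V V' where V: "torsion_pair A U V" "torsion_pair A U' V'"
    using assms(2,3) unfolding torsion_class_def by blast
  note U = torsion_pair.torsion_eq_left_perp[OF V(1)] and U' = torsion_pair.torsion_eq_left_perp[OF V(2)]
  fix M assume M: "M \<in> U"
  then have "M \<in> Ob A" using torsion_pair.torsion_objects[OF V(1)] by blast
  then obtain X Z f g where e: "X \<in> C" "Z \<in> D" "f \<in> Hom A X M" "g \<in> Hom A M Z"
    "is_kernel A f g" "is_cokernel A g f"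
    using torsion_pair.torsion_sequenceE[OF assms(1)] by metis
  have "Z \<in> U" using left_perp_epi[OF _ cokernel_epi[OF e(6)] e(4)] M U by blast
  then have "X \<in> U'" "Z \<in> U'" using e assms by auto
  then show "M \<in> U'" using left_perp_extension[OF _ _ e(6,3,4)] U' by blast
qed

context abelian_length_category
begin

text \<open>
  Adding \<open>D'\<close> to \<open>F\<close> cuts \<open>left_perp A F\<close> down to \<open>C'\<close>, while \<open>C\<close> survives because \<open>F \<subseteq> D\<close>. When
  \<open>F\<close> is the torsion-free class of a torsion pair of the subcategory, \<open>U\<close> is the torsion class of
  \<open>A\<close> that lifts it; for arbitrary \<open>F\<close>, the last two facts show that left orthogonals in
  the subcategory are torsion classes.
\<close>

lemma torsion_class_in_interval:
  assumes "torsion_pair A C D" "torsion_pair A C' D'" "C \<subseteq> C'" and F: "F \<subseteq> C' \<inter> D"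
  defines "U \<equiv> left_perp A (F \<union> D')"
  shows "torsion_class A U" "C \<subseteq> U" "U \<subseteq> C'" "U \<inter> D = left_perp (full_subcategory A (C' \<inter> D)) F"
    "torsion_class (full_subcategory A (C' \<inter> D)) (U \<inter> D)"
proof -
  note C = torsion_pair.torsion_eq_left_perp[OF assms(1)]
  note C' = torsion_pair.torsion_eq_left_perp[OF assms(2)]
  have U: "U = left_perp A F \<inter> C'" unfolding U_def left_perp_Un using C' by simp
  have pair: "torsion_pair A U (right_perp A U)" unfolding U_def by (rule left_perp_torsion_pair)
  then show "torsion_class A U" unfolding torsion_class_def by blast
  have "C \<subseteq> left_perp A F" using left_perp_antimono[of F D A] F C by auto
  then show CU: "C \<subseteq> U" unfolding U using assms(3) by blast
  show UC': "U \<subseteq> C'" unfolding U by blast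
  show "U \<inter> D = left_perp (full_subcategory A (C' \<inter> D)) F"
    unfolding U left_perp_full_subcategory[OF F] by blast
  show "torsion_class (full_subcategory A (C' \<inter> D)) (U \<inter> D)"
    using torsion_pair_restrict[OF assms(1,2) pair CU UC'] unfolding torsion_class_def by blast
qed

lemma torsion_classes_order_isomorphic_interval:
  assumes "torsion_pair A C D" "torsion_pair A C' D'" "C \<subseteq> C'"
  shows "order_isomorphic (torsion_classes (full_subcategory A (C' \<inter> D)))
    (interval_lattice (torsion_classes A) C C')" (is "order_isomorphic (torsion_classes ?B) ?I")
proof -
  \<comment> \<open>\<open>\<phi>\<close> is the inverse of \<open>U \<mapsto> U \<inter> D\<close>; \<open>right_perp ?B T\<close> is the torsion-free class of \<open>T\<close>.\<close>
  define \<phi> where "\<phi> T = left_perp A (right_perp ?B T \<union> D')" for T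
  have I: "carrier ?I = {U. torsion_class A U \<and> C \<subseteq> U \<and> U \<subseteq> C'}"
    by (auto simp: interval_lattice_def at_least_at_most_def torsion_classes_def)
  have inter: "\<phi> T \<inter> D = T" and mem: "\<phi> T \<in> carrier ?I" if T: "torsion_class ?B T" for T
  proof -
    obtain F where F: "torsion_pair ?B T F" using T unfolding torsion_class_def by blast
    have FB: "F \<subseteq> C' \<inter> D" using torsion_pair.torsion_free_objects[OF F] by simp
    have \<phi>: "\<phi> T = left_perp A (F \<union> D')"
      unfolding \<phi>_def torsion_pair.torsion_free_eq_right_perp[OF F, symmetric] ..
    note U = torsion_class_in_interval[OF assms FB, folded \<phi>]
    show "\<phi> T \<inter> D = T" using U(4) torsion_pair.torsion_eq_left_perp[OF F] by simp
    show "\<phi> T \<in> carrier ?I" using U unfolding I by blast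
  qed
  have le: "U \<inter> D \<subseteq> U' \<inter> D \<longleftrightarrow> U \<subseteq> U'" if "U \<in> carrier ?I" "U' \<in> carrier ?I" for U U'
    using torsion_class_le_if_inter_le[OF assms(1), of U U'] that unfolding I by blast
  have emb: "\<phi> S \<subseteq> \<phi> T \<longleftrightarrow> S \<subseteq> T" if "torsion_class ?B S" "torsion_class ?B T" for S T
    using le[OF mem mem, OF that] inter that by simp
  have "bij_betw \<phi> (carrier (torsion_classes ?B)) (carrier ?I)"
  proof (rule bij_betw_byWitness[where f' = "\<lambda>U. U \<inter> D"])
    have restrict: "torsion_class ?B (U \<inter> D)" if "U \<in> carrier ?I" for U
      using that torsion_pair_restrict[OF assms(1,2)] unfolding I torsion_class_def by blast
    then show "(\<lambda>U. U \<inter> D) ` carrier ?I \<subseteq> carrier (torsion_classes ?B)"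
      by (auto simp: torsion_classes_def)
    show "\<phi> ` carrier (torsion_classes ?B) \<subseteq> carrier ?I"
      using mem by (auto simp: torsion_classes_def)
    show "\<forall>T \<in> carrier (torsion_classes ?B). \<phi> T \<inter> D = T"
      using inter by (auto simp: torsion_classes_def)
    show "\<forall>U \<in> carrier ?I. \<phi> (U \<inter> D) = U"
      using le mem restrict inter by (metis subset_antisym subset_refl)
  qed
  moreover have "weak_partial_order (torsion_classes ?B)" "weak_partial_order (torsion_classes A)"
    using partial_order_torsion_classes partial_order.axioms(1) by blast+
  moreover from this(2) have "weak_partial_order ?I"
    unfolding interval_lattice_def
    by (rule weak_partial_order_subset) (auto simp: at_least_at_most_def)
  ultimately show ?thesis
    unfolding order_isomorphic_def order_emb_def using emb
    by (intro exI[of _ \<phi>]) (auto simp: interval_lattice_def torsion_classes_def)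
qed

end

theorem corollary4p5:
  fixes A :: "('o, 'm) preadditive_data" and C D C' D' :: "'o set"
  assumes "abelian_length_category A"
    and "torsion_pair A C D"
    and "torsion_pair A C' D'"
    and "C \<subseteq> C'"
  shows "complete_lattice (torsion_classes A)
    \<and> complete_lattice (torsion_classes (full_subcategory A (C' \<inter> D)))
    \<and> order_isomorphic (torsion_classes (full_subcategory A (C' \<inter> D)))
        (interval_lattice (torsion_classes A) C C')"
proof (intro conjI)
  interpret abelian_length_category A by fact
  interpret B: pre_abelian_category "full_subcategory A (C' \<inter> D)"
    using pre_abelian_full_subcategory assms by blast
  show "complete_lattice (torsion_classes A)"
    using complete_lattice_torsion_classes left_perp_torsion_pair torsion_class_def by blast
  show "complete_lattice (torsion_classes (full_subcategory A (C' \<inter> D)))"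
  proof (rule B.complete_lattice_torsion_classes)
    fix F assume "F \<subseteq> Ob (full_subcategory A (C' \<inter> D))"
    then have "F \<subseteq> C' \<inter> D" by simp
    from torsion_class_in_interval(4,5)[OF assms(2-4) this]
    show "torsion_class (full_subcategory A (C' \<inter> D)) (left_perp (full_subcategory A (C' \<inter> D)) F)"
      by simp
  qed
  show "order_isomorphic (torsion_classes (full_subcategory A (C' \<inter> D)))
    (interval_lattice (torsion_classes A) C C')"
    using torsion_classes_order_isomorphic_interval assms by blast
qed

end
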